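(* Let $\ell$ be a classification loss function with Lipschitz constant $\mathrm{L}_{\mathrm{Lip}}$ (in the graph argument, with respect to the norm $\|\cdot\|$ on graphs) and with $\ell(\cdot,\cdot)\in[0,1]$. Let $$\theta_\star=\arg\min_{\theta}\mathcal L_\theta,\qquad \mathcal L_\theta=\frac1N\sum_{n=1}^N\ell(\mathcal G_n,\theta),$$ be the optimal parameters in the non-augmented setting, and let $$\hat\theta_{\mathrm{aug}}=\arg\min_{\theta}\frac{1}{NM}\sum_{n=1}^N\sum_{m=1}^M\ell(\widetilde{\mathcal G}_n^m,\theta)$$ be the empirical optimal parameters in the augmented setting, where for each training graph $\mathcal G_n$ the graphs $\widetilde{\mathcal G}_n^1,\dots,\widetilde{\mathcal G}_n^M$ are $M$ augmented graphs sampled from $A_\lambda$ applied to $\mathcal G_n$. Then, with probability at least $1-\delta$ over the samples $\mathcal D_{\mathrm{train}}$, $$\mathbb{E}_{\mathcal G\sim\mathcal D}\left[\ell(\mathcal G,\hat\theta_{\mathrm{aug}})\right]-\mathbb{E}_{\mathcal G\sim\mathcal D}\left[\ell(\mathcal G,\theta_\star)\right]\le 2\,\mathcal R(\ell_{\mathrm{aug}})+5\sqrt{\frac{2\log(4/\delta)}{N}}+2\,\mathrm{L}_{\mathrm{Lip}}\,\mathbb{E}_{\mathcal G\sim\mathcal D,\ \widetilde{\mathcal G}\sim A_\lambda}\left[\|\widetilde{\mathcal G}-\mathcal G\|\right].$$ Moreover, $$\mathcal R(\ell_{\mathrm{aug}})\le\mathcal R(\ell)+\max_{n}\ \mathrm{L}_{\mathrm{Lip}}\,\mathbb{E}_{\widetilde{\mathcal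 G}_n^m\sim A_\lambda}\left[\|\widetilde{\mathcal G}_n^m-\mathcal G_n\|\right].$$
   Context: The task is graph classification. $\mathcal D$ is the distribution of graphs, and $\mathcal D_{\mathrm{train}}=\{(\mathcal G_n,y_n): n=1,\dots,N\}$ is a training set of $N$ graphs with class labels. $f(\cdot,\theta)$ is a graph neural network with parameters $\theta$ in the hypothesis class $\Theta$, and $\ell(\mathcal G,\theta)$ abbreviates the loss $\ell(f(\mathcal G,\theta),y)$, where $y$ is the label of $\mathcal G$ (for an augmented graph, its augmented label). The norm $\|\cdot\|$ is any norm on the graph input space (pairs of adjacency matrix and node feature matrix, with a bounded number of nodes, a finite-dimensional real vector space). A graph augmentation generator $A_\lambda$, parameterized by $\lambda$, maps a labelled graph $(\mathcal G_n,y_n)$ to an augmented labelled graph; it may be deterministic or stochastic. $\widetilde{\mathcal G}_n^m\sim A_\lambda$ means that $(\widetilde{\mathcal G}_n^m,\widetilde y_n^m)\sim A_\lambda(\mathcal G_n,y_n)$, and likewise $\widetilde{\mathcal G}\sim A_\lambda$ is an augmentation of $\mathcal G$. $M$ is the number of augmented graphs generated per training graph. The augmented loss attached to $\mathcal G_n$ is $\ell_{\mathrm{aug}}(\mathcal G_n,\theta)=\mathbb{E}_{\widetilde{\mathcal G}_n^m\sim A_\lambda}\left[\ell(f(\widetilde{\mathcal G}_n^m,\theta),\widetilde y_n^m)\right]$. The Rademacher complexity is $$\mathcal R(\ell)=\mathbb{E}_{\epsilon}\left[\sup_{\theta\in\Theta}\left|\frac1N\sum_{n=1}^N\epsilon_n\,\ell(\mathcal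 G_n,\theta)\right|\right],$$ where $\epsilon_1,\dots,\epsilon_N$ are independent Rademacher variables, taking the values $+1$ and $-1$ with equal probability; $\mathcal R(\ell_{\mathrm{aug}})$ is the same expression with $\ell_{\mathrm{aug}}$ in place of $\ell$.
   Formalization: The first bound is proved for all sufficiently large M (threshold may depend on the other data), as it fails for fixed M; the Lipschitz condition is also required between a labelled graph and its augmentations with their augmented labels, since label flips break the claim. *)

theory Defs
  imports "HOL-Probability.Probability"
begin

text \<open>
  A graph is an adjacency matrix together with a node feature matrix. The number of nodes is
  bounded by the cardinality of \<open>'n\<close>; smaller graphs are padded with zeros, so that differences
  of graphs are taken in one fixed finite-dimensional vector space.
\<close>

type_synonym ('n, 'd) graph = "(real ^ 'n ^ 'n) \<times> (real ^ 'd ^ 'n)"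

type_synonym ('n, 'd, 'y) lgraph = "('n, 'd) graph \<times> 'y"

definition lgraphs :: "('n::finite, 'd::finite, 'y) lgraph measure" where
  "lgraphs = borel \<Otimes>\<^sub>M count_space UNIV"

definition is_norm :: "('v::real_vector \<Rightarrow> real) \<Rightarrow> bool" where
  "is_norm \<nu> \<longleftrightarrow>
     (\<forall>x. \<nu> x = 0 \<longleftrightarrow> x = 0) \<and>
     (\<forall>c x. \<nu> (c *\<^sub>R x) = \<bar>c\<bar> * \<nu> x) \<and>
     (\<forall>x y. \<nu> (x + y) \<le> \<nu> x + \<nu> y)"

definition gloss :: "('p \<Rightarrow> 'y \<Rightarrow> real) \<Rightarrow> ('g \<Rightarrow> 't \<Rightarrow> 'p) \<Rightarrow> 'g \<times> 'y \<Rightarrow> 't \<Rightarrow> real" where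
  "gloss l f z \<theta> = l (f (fst z) \<theta>) (snd z)"

definition aug_loss ::
    "('p \<Rightarrow> 'y \<Rightarrow> real) \<Rightarrow> ('g \<Rightarrow> 't \<Rightarrow> 'p) \<Rightarrow> ('g \<times> 'y \<Rightarrow> ('g \<times> 'y) measure) \<Rightarrow> 'g \<times> 'y \<Rightarrow> 't \<Rightarrow> real"
  where "aug_loss l f K z \<theta> = (\<integral>w. gloss l f w \<theta> \<partial>K z)"

text \<open>
  The loss of a graph is evaluated at the graph's own label, and the augmented graph carries its
  augmented label. Lipschitz continuity in the graph therefore means: for graphs with a common
  label, and between a labelled graph and its augmentations (where it follows from the first
  clause if the augmentation keeps the label). Asking for it between arbitrary labelled graphs
  would, at equal graphs, make the loss independent of the label.
\<close>

definition lipschitz_loss ::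
    "('g::real_vector \<Rightarrow> real) \<Rightarrow> real \<Rightarrow> 't set \<Rightarrow> ('p \<Rightarrow> 'y \<Rightarrow> real) \<Rightarrow> ('g \<Rightarrow> 't \<Rightarrow> 'p)
      \<Rightarrow> ('g \<times> 'y \<Rightarrow> ('g \<times> 'y) measure) \<Rightarrow> bool"
  where
  "lipschitz_loss \<nu> L \<Theta> l f K \<longleftrightarrow>
     0 \<le> L \<and>
     (\<forall>\<theta>\<in>\<Theta>. \<forall>y G G'. \<bar>gloss l f (G', y) \<theta> - gloss l f (G, y) \<theta>\<bar> \<le> L * \<nu> (G' - G)) \<and>
     (\<forall>\<theta>\<in>\<Theta>. \<forall>y G. AE w in K (G, y).
        \<bar>gloss l f w \<theta> - gloss l f (G, y) \<theta>\<bar> \<le> L * \<nu> (fst w - G))"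

text \<open>The expectation of the augmentation displacement, possibly infinite.\<close>

definition displacement ::
    "('g::real_vector \<Rightarrow> real) \<Rightarrow> ('g \<times> 'y \<Rightarrow> ('g \<times> 'y) measure) \<Rightarrow> 'g \<times> 'y \<Rightarrow> ennreal"
  where "displacement \<nu> K z = (\<integral>\<^sup>+ w. ennreal (\<nu> (fst w - fst z)) \<partial>K z)"

text \<open>
  \<open>h n \<theta>\<close> is the loss of the \<open>n\<close>-th training graph; the training graphs are indexed by
  \<open>0, \<dots>, N - 1\<close>.
\<close>

definition rademacher :: "nat \<Rightarrow> 't set \<Rightarrow> (nat \<Rightarrow> 't \<Rightarrow> real) \<Rightarrow> real" where
  "rademacher N \<Theta> h =
     measure_pmf.expectation (Pi_pmf {..<N} 0 (\<lambda>_. pmf_of_set {-1, 1 :: real}))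
       (\<lambda>\<epsilon>. SUP \<theta>\<in>\<Theta>. \<bar>1 / real N * (\<Sum>n<N. \<epsilon> n * h n \<theta>)\<bar>)"

definition train_risk ::
    "('p \<Rightarrow> 'y \<Rightarrow> real) \<Rightarrow> ('g \<Rightarrow> 't \<Rightarrow> 'p) \<Rightarrow> nat \<Rightarrow> (nat \<Rightarrow> 'g \<times> 'y) \<Rightarrow> 't \<Rightarrow> real"
  where "train_risk l f N S \<theta> = 1 / real N * (\<Sum>n<N. gloss l f (S n) \<theta>)"

definition aug_train_risk ::
    "('p \<Rightarrow> 'y \<Rightarrow> real) \<Rightarrow> ('g \<Rightarrow> 't \<Rightarrow> 'p) \<Rightarrow> nat \<Rightarrow> nat \<Rightarrow> (nat \<times> nat \<Rightarrow> 'g \<times> 'y) \<Rightarrow> 't \<Rightarrow> real"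
  where "aug_train_risk l f N M T \<theta> =
    1 / (real N * real M) * (\<Sum>n<N. \<Sum>m<M. gloss l f (T (n, m)) \<theta>)"

text \<open>
  The joint law of the training set \<open>S\<close>, i.i.d. from \<open>D\<close>, and of the augmented graphs \<open>T\<close>, which
  are independent given \<open>S\<close>, the entry \<open>T (n, m)\<close> being drawn from \<open>K (S n)\<close>.
\<close>

definition train_measure :: "'z measure \<Rightarrow> nat \<Rightarrow> (nat \<Rightarrow> 'z) measure" where
  "train_measure D N = (\<Pi>\<^sub>M n\<in>{..<N}. D)"

definition aug_measure ::
    "('z \<Rightarrow> 'z measure) \<Rightarrow> nat \<Rightarrow> nat \<Rightarrow> (nat \<Rightarrow> 'z) \<Rightarrow> (nat \<times> nat \<Rightarrow> 'z) measure"
  where "aug_measure K N M S = (\<Pi>\<^sub>M (n, m)\<in>{..<N} \<times> {..<M}. K (S n))"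

definition sample_measure ::
    "'z measure \<Rightarrow> ('z \<Rightarrow> 'z measure) \<Rightarrow> nat \<Rightarrow> nat \<Rightarrow> ((nat \<Rightarrow> 'z) \<times> (nat \<times> nat \<Rightarrow> 'z)) measure"
  where
  "sample_measure D K N M =
     train_measure D N \<bind> (\<lambda>S. distr (aug_measure K N M S)
       (train_measure D N \<Otimes>\<^sub>M (\<Pi>\<^sub>M nm\<in>{..<N} \<times> {..<M}. D)) (\<lambda>T. (S, T)))"

text \<open>
  The set of good samples involves minimizers over an arbitrary parameter set and need not be
  measurable itself, so it is only required to contain a measurable event of the given probability.
\<close>

definition with_prob_at_least :: "'a measure \<Rightarrow> real \<Rightarrow> ('a \<Rightarrow> bool) \<Rightarrow> bool" where
  "with_prob_at_least P p Q \<longleftrightarrow> (\<exists>E\<in>sets P. measure P E \<ge> p \<and> (\<forall>\<omega>\<in>E. Q \<omega>))"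

end

theory Submission
  imports Defs
begin

text \<open>
  Write \<open>t = sqrt (2 ln (4 / \<delta>) / N)\<close>. Any \<open>\<theta>s\<close> is at best as good as a fixed parameter \<open>\<theta>0\<close> whose
  population risk is within \<open>t\<close> of the infimum, so the excess risk of \<open>\<theta>a\<close> need only be bounded relative
  to \<open>\<theta>0\<close>; this is why a single Rademacher term with factor 2 suffices although \<open>\<theta>s\<close> depends on the
  sample. Passing from the loss to the augmented loss costs the Lipschitz constant times the expected
  displacement, once for \<open>\<theta>a\<close> and once for \<open>\<theta>0\<close>. The statistic
  \<open>sup\<^sub>\<theta> (aug_risk \<theta> - emp_risk \<theta>) + (emp_risk \<theta>0 - aug_risk \<theta>0) - 2 rademacher\<close> has mean at most 0 by
  symmetrization and changes by at most \<open>4 / N\<close> with each training graph, so one use of McDiarmid's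
  inequality keeps it below \<open>2 t\<close>. The remaining \<open>2 t\<close> absorb the error of sampling \<open>M\<close> augmentations, which tends to
  0 uniformly in \<open>\<theta>\<close>: up to a set of small probability the graphs fall into finitely many cells on which
  every loss function of the class is nearly constant, and the empirical frequencies of the cells converge.

  Suprema over \<open>\<Theta>\<close> are made measurable by restricting them to a countable subset of \<open>\<Theta>\<close> that is
  sequentially dense for pointwise convergence of the losses; it exists because the losses are
  equi-Lipschitz on a separable space.
\<close>

section \<open>McDiarmid's inequality\<close>

lemma measurable_fun_upd_PiM:
  assumes "f \<in> borel_measurable (PiM (insert i I) M)"
  shows "(\<lambda>(x, y). f (x(i := y))) \<in> borel_measurable (PiM I M \<Otimes>\<^sub>M M i)"
  using measurable_compose[OF measurable_add_dim assms] by (simp add: case_prod_unfold)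

lemma fun_upd_in_space_PiM:
  "x \<in> space (PiM I M) \<Longrightarrow> y \<in> space (M i) \<Longrightarrow> x(i := y) \<in> space (PiM (insert i I) M)"
  unfolding space_PiM by (rule PiE_fun_upd)

text \<open>McDiarmid's hypothesis controls only the oscillation of \<open>f\<close>. The interval
  that Hoeffding's lemma asks for is therefore taken to start at the infimum of \<open>f\<close> and
  to have length \<open>c\<close>.\<close>

lemma (in prob_space) Hoeffdings_lemma_oscillation:
  fixes f :: "'a \<Rightarrow> real"
  assumes [measurable]: "f \<in> borel_measurable M"
    and bd: "\<And>x y. x \<in> space M \<Longrightarrow> y \<in> space M \<Longrightarrow> \<bar>f x - f y\<bar> \<le> c"
    and s: "s > 0"
  shows "(\<integral>\<^sup>+x. exp (s * (f x - expectation f)) \<partial>M) \<le> ennreal (exp (s\<^sup>2 * c\<^sup>2 / 8))"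
proof -
  obtain x0 where x0: "x0 \<in> space M" using not_empty by auto
  define a where "a = (INF x\<in>space M. f x)"
  have bb: "bdd_below (f ` space M)"
  proof (rule bdd_belowI2)
    fix x assume "x \<in> space M"
    then show "f x0 - c \<le> f x" using bd[OF x0, of x] by linarith
  qed
  have lo: "a \<le> f x" if "x \<in> space M" for x
    unfolding a_def by (rule cINF_lower[OF bb that])
  have hi: "f x \<le> a + c" if "x \<in> space M" for x
  proof -
    have "f x - c \<le> a" unfolding a_def
    proof (rule cINF_greatest)
      fix y assume "y \<in> space M"
      then show "f x - c \<le> f y" using bd[OF that, of y] by linarith
    qed (use x0 in auto)
    then show ?thesis by simp
  qed
  interpret interval_bounded_random_variable M f a "a + c"
    by unfold_locales (auto intro!: AE_I2 lo hi)
  show ?thesis using Hoeffdings_lemma_nn_integral[OF s] by simp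
qed

text \<open>Induction over the coordinates replaces the usual martingale. Averaging \<open>f\<close>
  over the coordinate \<open>i\<close> gives a function \<open>g\<close> of the others with the same
  mean and the same bounded differences, so the induction hypothesis applies to \<open>g\<close>.
  For fixed other coordinates, \<open>f - g\<close> is centred in the coordinate \<open>i\<close>,
  and Hoeffding's lemma contributes the factor with \<open>c i\<close>.\<close>

lemma mcdiarmid_mgf:
  fixes f :: "('i \<Rightarrow> 'a) \<Rightarrow> real"
  assumes "finite I" and M: "\<And>i. prob_space (M i)"
    and "f \<in> borel_measurable (PiM I M)"
    and "\<And>x. x \<in> space (PiM I M) \<Longrightarrow> \<bar>f x\<bar> \<le> B"
    and "\<And>i x y. i \<in> I \<Longrightarrow> x \<in> space (PiM I M) \<Longrightarrow> y \<in> space (M i) \<Longrightarrow> \<bar>f x - f (x(i := y))\<bar> \<le> c i"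
    and s: "s > 0"
  shows "(\<integral>\<^sup>+x. exp (s * (f x - (\<integral>x. f x \<partial>PiM I M))) \<partial>PiM I M)
    \<le> ennreal (exp (s\<^sup>2 * (\<Sum>i\<in>I. (c i)\<^sup>2) / 8))"
  using assms(1,3-5)
proof (induction I arbitrary: f rule: finite_induct)
  case empty
  interpret prob_space "PiM {} M" by (rule prob_space_PiM) (rule M)
  \<comment> \<open>The empty product space has the single point
    \<open>\<lambda>_. undefined\<close>, so \<open>f\<close> is constant there.\<close>
  have "(\<integral>x. f x \<partial>PiM {} M) = (\<integral>x. f (\<lambda>_. undefined) \<partial>PiM {} M)"
    by (rule Bochner_Integration.integral_cong) (auto simp: space_PiM)
  then have "(\<integral>x. f x \<partial>PiM {} M) = f (\<lambda>_. undefined)"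
    by (simp only: lebesgue_integral_const prob_space) simp
  moreover have "(\<integral>\<^sup>+x. exp (s * (f x - f (\<lambda>_. undefined))) \<partial>PiM {} M) = (\<integral>\<^sup>+x. 1 \<partial>PiM {} M)"
    by (intro nn_integral_cong) (auto simp: space_PiM)
  ultimately show ?case by (simp add: emeasure_space_1)
next
  case (insert i I)
  interpret product_sigma_finite M
    by (intro product_sigma_finite.intro prob_space_imp_sigma_finite M)
  interpret P: prob_space "PiM I M" by (rule prob_space_PiM) (rule M)
  interpret PI: prob_space "PiM (insert i I) M" by (rule prob_space_PiM) (rule M)
  interpret Mi: prob_space "M i" by (rule M)
  note [measurable] = insert.prems(1)
  note upd = fun_upd_in_space_PiM
  have m2 [measurable]: "(\<lambda>(x, y). f (x(i := y))) \<in> borel_measurable (PiM I M \<Otimes>\<^sub>M M i)"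
    by (rule measurable_fun_upd_PiM) fact
  define g where "g x = (\<integral>y. f (x(i := y)) \<partial>M i)" for x
  have mi: "(\<lambda>y. f (x(i := y))) \<in> borel_measurable (M i)" if "x \<in> space (PiM I M)" for x
    using measurable_Pair2[OF m2 that] by simp
  have B: "\<bar>f (x(i := y))\<bar> \<le> B" if "x \<in> space (PiM I M)" "y \<in> space (M i)" for x y
    by (intro insert.prems(2) upd that)
  have inti: "integrable (M i) (\<lambda>y. f (x(i := y)))" if "x \<in> space (PiM I M)" for x
    using mi[OF that] B[OF that] by (intro Mi.integrable_const_bound[of _ B]) auto
  have g_meas [measurable]: "g \<in> borel_measurable (PiM I M)"
    unfolding g_def by measurable
  have g_bd: "\<bar>g x\<bar> \<le> B" if "x \<in> space (PiM I M)" for x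
    unfolding g_def using Mi.integral_le_const[OF inti[OF that], of B]
      Mi.integral_ge_const[OF inti[OF that], of "- B"] B[OF that] by (force simp: abs_le_iff)
  \<comment> \<open>The differences survive averaging because the update at \<open>j\<close>
    commutes with the update at \<open>i\<close>, so that they may be compared for each value of the
    averaged coordinate.\<close>
  have g_diff: "\<bar>g x - g (x(j := y))\<bar> \<le> c j" if j: "j \<in> I" and x: "x \<in> space (PiM I M)" and y: "y \<in> space (M j)" for j x y
  proof -
    have x': "x(j := y) \<in> space (PiM I M)"
      using upd[OF x y] j by (simp add: insert_absorb)
    have ij: "i \<noteq> j" using insert.hyps j by auto
    have d: "\<bar>f (x(i := z)) - f (x(j := y, i := z))\<bar> \<le> c j" if "z \<in> space (M i)" for z
      using insert.prems(3)[OF insertI2[OF j] upd[OF x that] y] unfolding fun_upd_twist[OF ij, of x z y] .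
    have "g x - g (x(j := y)) = (\<integral>z. f (x(i := z)) - f (x(j := y, i := z)) \<partial>M i)"
      unfolding g_def by (rule Bochner_Integration.integral_diff[symmetric]) (intro inti x x')+
    moreover have I: "integrable (M i) (\<lambda>z. f (x(i := z)) - f (x(j := y, i := z)))"
      by (intro Bochner_Integration.integrable_diff inti x x')
    ultimately show ?thesis
      using Mi.integral_le_const[OF I, of "c j"] Mi.integral_ge_const[OF I, of "- c j"] d
      by (force simp: abs_le_iff)
  qed
  have "integrable (PiM (insert i I) M) f"
    using insert.prems(2) by (intro PI.integrable_const_bound[of _ B]) auto
  then have Eg: "(\<integral>x. f x \<partial>PiM (insert i I) M) = (\<integral>x. g x \<partial>PiM I M)"
    unfolding g_def using insert.hyps by (intro product_integral_insert)
  define E where "E = (\<integral>x. g x \<partial>PiM I M)"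
  \<comment> \<open>Factor \<open>exp (s * (f - E))\<close> as \<open>exp (s * (f - g))\<close>
    times \<open>exp (s * (g - E))\<close>. The second factor is constant in \<open>y\<close>, and
    \<open>g x\<close> is the mean of the inner function.\<close>
  have inner: "(\<integral>\<^sup>+y. exp (s * (f (x(i := y)) - E)) \<partial>M i)
      \<le> ennreal (exp (s\<^sup>2 * (c i)\<^sup>2 / 8)) * ennreal (exp (s * (g x - E)))"
    if x: "x \<in> space (PiM I M)" for x
  proof -
    have d: "\<bar>f (x(i := y)) - f (x(i := z))\<bar> \<le> c i" if "y \<in> space (M i)" "z \<in> space (M i)" for y z
      using insert.prems(3)[OF insertI1 upd[OF x that(1)] that(2)] unfolding fun_upd_upd .
    note [measurable] = mi[OF x]
    have "(\<integral>\<^sup>+y. exp (s * (f (x(i := y)) - E)) \<partial>M i)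
        = (\<integral>\<^sup>+y. ennreal (exp (s * (f (x(i := y)) - g x))) * ennreal (exp (s * (g x - E))) \<partial>M i)"
      by (intro nn_integral_cong) (simp add: exp_add[symmetric] ennreal_mult[symmetric] algebra_simps)
    also have "\<dots> = (\<integral>\<^sup>+y. ennreal (exp (s * (f (x(i := y)) - g x))) \<partial>M i) * ennreal (exp (s * (g x - E)))"
      by (rule nn_integral_multc) measurable
    also have "\<dots> \<le> ennreal (exp (s\<^sup>2 * (c i)\<^sup>2 / 8)) * ennreal (exp (s * (g x - E)))"
      using Mi.Hoeffdings_lemma_oscillation[OF mi[OF x] d s] by (intro mult_right_mono) (auto simp: g_def)
    finally show ?thesis .
  qed
  have "(\<integral>\<^sup>+x. exp (s * (f x - E)) \<partial>PiM (insert i I) M)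
      = (\<integral>\<^sup>+x. \<integral>\<^sup>+y. exp (s * (f (x(i := y)) - E)) \<partial>M i \<partial>PiM I M)"
    using insert.hyps by (intro product_nn_integral_insert) auto
  also have "\<dots> \<le> (\<integral>\<^sup>+x. ennreal (exp (s\<^sup>2 * (c i)\<^sup>2 / 8)) * ennreal (exp (s * (g x - E))) \<partial>PiM I M)"
    by (intro nn_integral_mono inner)
  also have "\<dots> = ennreal (exp (s\<^sup>2 * (c i)\<^sup>2 / 8)) * (\<integral>\<^sup>+x. ennreal (exp (s * (g x - E))) \<partial>PiM I M)"
    by (rule nn_integral_cmult) measurable
  also have "\<dots> \<le> ennreal (exp (s\<^sup>2 * (c i)\<^sup>2 / 8)) * ennreal (exp (s\<^sup>2 * (\<Sum>i\<in>I. (c i)\<^sup>2) / 8))"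
    using insert.IH[OF g_meas g_bd g_diff] by (intro mult_left_mono) (auto simp: E_def)
  also have "\<dots> = ennreal (exp (s\<^sup>2 * (\<Sum>i\<in>insert i I. (c i)\<^sup>2) / 8))"
    using insert.hyps by (simp add: ennreal_mult[symmetric] exp_add[symmetric] algebra_simps add_divide_distrib)
  finally show ?case unfolding Eg E_def .
qed

theorem mcdiarmid:
  fixes f :: "('i \<Rightarrow> 'a) \<Rightarrow> real"
  assumes I: "finite I" and M: "\<And>i. prob_space (M i)"
    and f [measurable]: "f \<in> borel_measurable (PiM I M)"
    and B: "\<And>x. x \<in> space (PiM I M) \<Longrightarrow> \<bar>f x\<bar> \<le> B"
    and d: "\<And>i x y. i \<in> I \<Longrightarrow> x \<in> space (PiM I M) \<Longrightarrow> y \<in> space (M i) \<Longrightarrow> \<bar>f x - f (x(i := y))\<bar> \<le> c i"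
    and V: "(\<Sum>i\<in>I. (c i)\<^sup>2) > 0" and t: "t > 0"
  shows "measure (PiM I M) {x \<in> space (PiM I M). f x \<ge> (\<integral>x. f x \<partial>PiM I M) + t}
    \<le> exp (- 2 * t\<^sup>2 / (\<Sum>i\<in>I. (c i)\<^sup>2))"
proof -
  interpret prob_space "PiM I M" by (rule prob_space_PiM) (rule M)
  define V where "V = (\<Sum>i\<in>I. (c i)\<^sup>2)"
  \<comment> \<open>This value minimizes the Chernoff exponent
    \<open>- s * t + s\<^sup>2 * V / 8\<close>; the minimum is
    \<open>- 2 * t\<^sup>2 / V\<close>.\<close>
  define s where "s = 4 * t / V"
  define E where "E = (\<integral>x. f x \<partial>PiM I M)"
  have V0: "V > 0" using V by (simp add: V_def)
  then have s: "s > 0" using t by (simp add: s_def)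
  have "emeasure (PiM I M) {x \<in> space (PiM I M). f x - E \<ge> t}
      \<le> ennreal (exp (- s * t)) * (\<integral>\<^sup>+x. ennreal (exp (s * (f x - E))) * indicator (space (PiM I M)) x \<partial>PiM I M)"
    by (rule Chernoff_ineq_nn_integral_ge[OF s]) auto
  also have "(\<integral>\<^sup>+x. ennreal (exp (s * (f x - E))) * indicator (space (PiM I M)) x \<partial>PiM I M)
      = (\<integral>\<^sup>+x. ennreal (exp (s * (f x - E))) \<partial>PiM I M)"
    by (intro nn_integral_cong) auto
  also have "ennreal (exp (- s * t)) * \<dots> \<le> ennreal (exp (- s * t)) * ennreal (exp (s\<^sup>2 * V / 8))"
    unfolding E_def V_def by (intro mult_left_mono mcdiarmid_mgf[OF I M f B d s]) auto
  also have "\<dots> = ennreal (exp (- 2 * t\<^sup>2 / V))"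
    using V0 by (simp add: ennreal_mult[symmetric] exp_add[symmetric] s_def power2_eq_square field_simps)
  finally have "measure (PiM I M) {x \<in> space (PiM I M). f x - E \<ge> t} \<le> exp (- 2 * t\<^sup>2 / V)"
    by (simp add: emeasure_eq_measure)
  moreover have "{x \<in> space (PiM I M). f x - E \<ge> t} = {x \<in> space (PiM I M). f x \<ge> E + t}" by auto
  ultimately show ?thesis unfolding V_def E_def by simp
qed

section \<open>Symmetrization\<close>

lemma abs_cSUP_le:
  fixes f :: "'t \<Rightarrow> real"
  assumes "T \<noteq> {}" "\<And>\<theta>. \<theta> \<in> T \<Longrightarrow> \<bar>f \<theta>\<bar> \<le> B"
  shows "\<bar>SUP \<theta>\<in>T. f \<theta>\<bar> \<le> B"
  using assms by (intro cSup_abs_le) auto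

lemma bdd_above_abs_bound:
  fixes f :: "'t \<Rightarrow> real"
  assumes "\<And>\<theta>. \<theta> \<in> T \<Longrightarrow> \<bar>f \<theta>\<bar> \<le> B"
  shows "bdd_above (f ` T)"
  using assms by (intro bdd_aboveI2[of _ _ B]) (force simp: abs_le_iff)

lemma cSUP_le_add:
  fixes f g :: "'t \<Rightarrow> real"
  assumes "T \<noteq> {}" "bdd_above (g ` T)" "\<And>\<theta>. \<theta> \<in> T \<Longrightarrow> f \<theta> \<le> g \<theta> + c"
  shows "(SUP \<theta>\<in>T. f \<theta>) \<le> (SUP \<theta>\<in>T. g \<theta>) + c"
proof (rule cSUP_least[OF assms(1)])
  fix \<theta> assume "\<theta> \<in> T"
  then show "f \<theta> \<le> (SUP \<theta>\<in>T. g \<theta>) + c"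
    using assms(3)[of \<theta>] cSUP_upper[OF _ assms(2), of \<theta>] by linarith
qed

lemma cSUP_diff_le:
  fixes f g :: "'t \<Rightarrow> real"
  assumes "T \<noteq> {}" "bdd_above (f ` T)" "bdd_above (g ` T)" "\<And>\<theta>. \<theta> \<in> T \<Longrightarrow> \<bar>f \<theta> - g \<theta>\<bar> \<le> c"
  shows "\<bar>(SUP \<theta>\<in>T. f \<theta>) - (SUP \<theta>\<in>T. g \<theta>)\<bar> \<le> c"
proof -
  have "f \<theta> \<le> g \<theta> + c" "g \<theta> \<le> f \<theta> + c" if "\<theta> \<in> T" for \<theta>
    using assms(4)[OF that] by auto
  then show ?thesis
    using cSUP_le_add[of T g f c] cSUP_le_add[of T f g c] assms(1-3) by (simp add: abs_le_iff)
qed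

text \<open>This is the sign distribution inside \<open>rademacher\<close>, over an arbitrary index
  set so that an induction can add one index at a time.\<close>

abbreviation signs :: "'i set \<Rightarrow> ('i \<Rightarrow> real) pmf" where
  "signs I \<equiv> Pi_pmf I 0 (\<lambda>_. pmf_of_set {-1, 1 :: real})"

lemma finite_set_pmf_signs: "finite I \<Longrightarrow> finite (set_pmf (signs I))"
  by (rule finite_subset[OF set_Pi_pmf_subset']) (auto intro!: finite_PiE_dflt)

lemma integrable_signs: "finite I \<Longrightarrow> integrable (measure_pmf (signs I)) (F :: _ \<Rightarrow> real)"
  by (rule integrable_measure_pmf_finite) (rule finite_set_pmf_signs)

lemma set_pmf_signsD: "finite I \<Longrightarrow> \<epsilon> \<in> set_pmf (signs I) \<Longrightarrow> i \<in> I \<Longrightarrow> \<bar>\<epsilon> i\<bar> = 1"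
  using set_Pi_pmf_subset'[of I 0 "\<lambda>_. pmf_of_set {-1, 1 :: real}"]
  by (fastforce simp: PiE_dflt_def)

lemma expectation_signs_mono:
  fixes F G :: "('i \<Rightarrow> real) \<Rightarrow> real"
  assumes "finite I" "\<And>\<epsilon>. \<epsilon> \<in> set_pmf (signs I) \<Longrightarrow> F \<epsilon> \<le> G \<epsilon>"
  shows "measure_pmf.expectation (signs I) F \<le> measure_pmf.expectation (signs I) G"
  using assms by (intro integral_mono_AE integrable_signs) (auto simp: AE_measure_pmf_iff)

text \<open>Conditioning on one sign produces the average of two terms, which is the shape of the
  bound in \<open>symmetrize_coordinate\<close>.\<close>

lemma expectation_signs_insert:
  fixes F :: "('i \<Rightarrow> real) \<Rightarrow> real"
  assumes "finite I" "i \<notin> I"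
  shows "measure_pmf.expectation (signs (insert i I)) F
    = (measure_pmf.expectation (signs I) (\<lambda>\<epsilon>. F (\<epsilon>(i := 1)))
       + measure_pmf.expectation (signs I) (\<lambda>\<epsilon>. F (\<epsilon>(i := -1)))) / 2"
proof -
  have "finite (set_pmf (signs I \<bind> (\<lambda>f. return_pmf (f(i := y)))))" for y
    using finite_set_pmf_signs[OF assms(1)] by auto
  then have "measure_pmf.expectation (signs (insert i I)) F
     = (\<Sum>y\<in>{-1, 1}. measure_pmf.expectation (signs I \<bind> (\<lambda>f. return_pmf (f(i := y)))) F / 2)"
    unfolding Pi_pmf_insert'[OF assms]
    by (subst pmf_expectation_bind_pmf_of_set) auto
  also have "\<dots> = (\<Sum>y\<in>{-1, 1}. measure_pmf.expectation (signs I) (\<lambda>f. F (f(i := y))) / 2)"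
    by (simp flip: map_pmf_def)
  finally show ?thesis by (simp add: add_divide_distrib)
qed

lemma expectation_signs_eq_sum:
  fixes F :: "('i \<Rightarrow> real) \<Rightarrow> real"
  assumes "finite I"
  shows "measure_pmf.expectation (signs I) F = (\<Sum>\<epsilon>\<in>set_pmf (signs I). pmf (signs I) \<epsilon> * F \<epsilon>)"
  using integral_measure_pmf[OF finite_set_pmf_signs[OF assms], of "signs I" F] by simp

text \<open>The sign distribution has finite support, so its expectation is a finite sum and the
  exchange is linearity of the integral.\<close>

lemma integral_expectation_signs:
  fixes F :: "('i \<Rightarrow> real) \<Rightarrow> 'a \<Rightarrow> real"
  assumes "finite I" "\<And>\<epsilon>. \<epsilon> \<in> set_pmf (signs I) \<Longrightarrow> integrable M (F \<epsilon>)"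
  shows "integrable M (\<lambda>x. measure_pmf.expectation (signs I) (\<lambda>\<epsilon>. F \<epsilon> x))"
    and "(\<integral>x. measure_pmf.expectation (signs I) (\<lambda>\<epsilon>. F \<epsilon> x) \<partial>M)
      = measure_pmf.expectation (signs I) (\<lambda>\<epsilon>. \<integral>x. F \<epsilon> x \<partial>M)"
  using assms(2) unfolding expectation_signs_eq_sum[OF assms(1)]
  by (auto simp: Bochner_Integration.integral_sum)

text \<open>Fubini for one extra coordinate. Symmetrization needs both orders: the new coordinate
  innermost to symmetrize it, and outermost to apply the induction hypothesis for each of its
  values.\<close>

lemma bounded_integral_PiM_insert:
  fixes G :: "('i \<Rightarrow> 'a) \<Rightarrow> real"
  assumes I: "finite I" "i \<notin> I" and M: "\<And>i. prob_space (M i)"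
    and G: "G \<in> borel_measurable (PiM (insert i I) M)"
    and B: "\<And>x. x \<in> space (PiM (insert i I) M) \<Longrightarrow> \<bar>G x\<bar> \<le> B"
  shows "(\<integral>x. G x \<partial>PiM (insert i I) M) = (\<integral>x. \<integral>y. G (x(i := y)) \<partial>M i \<partial>PiM I M)"
    and "(\<integral>x. G x \<partial>PiM (insert i I) M) = (\<integral>y. \<integral>x. G (x(i := y)) \<partial>PiM I M \<partial>M i)"
    and "integrable (PiM I M) (\<lambda>x. \<integral>y. G (x(i := y)) \<partial>M i)"
    and "integrable (M i) (\<lambda>y. \<integral>x. G (x(i := y)) \<partial>PiM I M)"
proof -
  interpret product_sigma_finite M
    by (intro product_sigma_finite.intro prob_space_imp_sigma_finite M)
  interpret P: prob_space "PiM I M" by (rule prob_space_PiM) (rule M)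
  interpret PI: prob_space "PiM (insert i I) M" by (rule prob_space_PiM) (rule M)
  interpret Mi: prob_space "M i" by (rule M)
  interpret pp: pair_prob_space "PiM I M" "M i" ..
  have m: "(\<lambda>(x, y). G (x(i := y))) \<in> borel_measurable (PiM I M \<Otimes>\<^sub>M M i)"
    by (rule measurable_fun_upd_PiM) fact
  have int: "integrable (PiM I M \<Otimes>\<^sub>M M i) (\<lambda>(x, y). G (x(i := y)))"
    using B fun_upd_in_space_PiM
    by (intro pp.P.integrable_const_bound[of _ B] m AE_I2) (fastforce simp: space_pair_measure)
  have "integrable (PiM (insert i I) M) G"
    using B G by (intro PI.integrable_const_bound[of _ B]) auto
  then show 1: "(\<integral>x. G x \<partial>PiM (insert i I) M) = (\<integral>x. \<integral>y. G (x(i := y)) \<partial>M i \<partial>PiM I M)"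
    by (rule product_integral_insert[OF I])
  show "(\<integral>x. G x \<partial>PiM (insert i I) M) = (\<integral>y. \<integral>x. G (x(i := y)) \<partial>PiM I M \<partial>M i)"
    unfolding 1 using pp.Fubini_integral[OF int] by simp
  show "integrable (PiM I M) (\<lambda>x. \<integral>y. G (x(i := y)) \<partial>M i)"
    using pp.integrable_fst[OF int] by simp
  show "integrable (M i) (\<lambda>y. \<integral>x. G (x(i := y)) \<partial>PiM I M)"
    using pp.integrable_snd[OF int] by simp
qed

text \<open>
  One coordinate is symmetrized by convexity alone, without a ghost sample:
  \<open>b + E h - h z = E (b + 2 h) / 2 + (b - 2 h z) / 2\<close>.
\<close>

lemma (in prob_space) symmetrize_coordinate:
  fixes h :: "'t \<Rightarrow> 'a \<Rightarrow> real"
  assumes T: "countable T" "T \<noteq> {}"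
    and h: "\<And>\<theta>. \<theta> \<in> T \<Longrightarrow> h \<theta> \<in> borel_measurable M"
    and H: "\<And>\<theta> z. \<theta> \<in> T \<Longrightarrow> z \<in> space M \<Longrightarrow> \<bar>h \<theta> z\<bar> \<le> H"
    and b: "\<And>\<theta>. \<theta> \<in> T \<Longrightarrow> \<bar>b \<theta>\<bar> \<le> B"
  shows "(\<integral>z. (SUP \<theta>\<in>T. b \<theta> + (expectation (h \<theta>) - h \<theta> z)) \<partial>M)
    \<le> ((\<integral>z. (SUP \<theta>\<in>T. b \<theta> + 2 * h \<theta> z) \<partial>M) + (\<integral>z. (SUP \<theta>\<in>T. b \<theta> - 2 * h \<theta> z) \<partial>M)) / 2"
proof -
  have bound: "\<bar>b \<theta> + c * h \<theta> z\<bar> \<le> B + \<bar>c\<bar> * H" if "\<theta> \<in> T" "z \<in> space M" for \<theta> z c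
    using b[OF that(1)] mult_left_mono[OF H[OF that], of "\<bar>c\<bar>"] abs_triangle_ineq[of "b \<theta>" "c * h \<theta> z"]
    by (simp add: abs_mult)
  have inth: "integrable M (h \<theta>)" if "\<theta> \<in> T" for \<theta>
    using H[OF that] h[OF that] by (intro integrable_const_bound[of _ H]) auto
  have bdd: "bdd_above ((\<lambda>\<theta>. b \<theta> + c * h \<theta> z) ` T)" if "z \<in> space M" for z c
    by (rule bdd_above_abs_bound) (rule bound[OF _ that])
  have int: "integrable M (\<lambda>z. SUP \<theta>\<in>T. b \<theta> + c * h \<theta> z)" for c
  proof (rule integrable_const_bound)
    show "AE z in M. norm (SUP \<theta>\<in>T. b \<theta> + c * h \<theta> z) \<le> B + \<bar>c\<bar> * H"
      by (intro AE_I2) (use abs_cSUP_le[OF T(2) bound] in simp)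
    show "(\<lambda>z. SUP \<theta>\<in>T. b \<theta> + c * h \<theta> z) \<in> borel_measurable M"
      using h by (intro borel_measurable_cSUP T bdd) auto
  qed
  define P where "P = (\<integral>z. (SUP \<theta>\<in>T. b \<theta> + 2 * h \<theta> z) \<partial>M)"
  \<comment> \<open>The mean of a supremum dominates each mean, so \<open>P\<close> bounds
    \<open>b \<theta> + 2 * expectation (h \<theta>)\<close> uniformly in
    \<open>\<theta>\<close>.\<close>
  have P: "b \<theta> + 2 * expectation (h \<theta>) \<le> P" if "\<theta> \<in> T" for \<theta>
  proof -
    have "(\<integral>z. b \<theta> + 2 * h \<theta> z \<partial>M) \<le> P" unfolding P_def
      using inth[OF that] that by (intro integral_mono int cSUP_upper bdd) auto
    then show ?thesis using inth[OF that] by (simp add: prob_space)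
  qed
  have H0: "\<bar>expectation (h \<theta>)\<bar> \<le> H" if "\<theta> \<in> T" for \<theta>
    using integral_le_const[OF inth[OF that], of H] integral_ge_const[OF inth[OF that], of "- H"] H[OF that]
    by (force simp: abs_le_iff)
  have bound2: "\<bar>b \<theta> + (expectation (h \<theta>) - h \<theta> z)\<bar> \<le> B + 2 * H" if "\<theta> \<in> T" "z \<in> space M" for \<theta> z
    using b[OF that(1)] H0[OF that(1)] H[OF that] by linarith
  have "(\<integral>z. (SUP \<theta>\<in>T. b \<theta> + (expectation (h \<theta>) - h \<theta> z)) \<partial>M)
      \<le> (\<integral>z. (P + (SUP \<theta>\<in>T. b \<theta> - 2 * h \<theta> z)) / 2 \<partial>M)"
  proof (rule integral_mono)
    show "integrable M (\<lambda>z. SUP \<theta>\<in>T. b \<theta> + (expectation (h \<theta>) - h \<theta> z))"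
    proof (rule integrable_const_bound)
      show "AE z in M. norm (SUP \<theta>\<in>T. b \<theta> + (expectation (h \<theta>) - h \<theta> z)) \<le> B + 2 * H"
        by (intro AE_I2) (use abs_cSUP_le[OF T(2) bound2] in simp)
      show "(\<lambda>z. SUP \<theta>\<in>T. b \<theta> + (expectation (h \<theta>) - h \<theta> z)) \<in> borel_measurable M"
        using h by (intro borel_measurable_cSUP T bdd_above_abs_bound[OF bound2]) auto
    qed
    show "integrable M (\<lambda>z. (P + (SUP \<theta>\<in>T. b \<theta> - 2 * h \<theta> z)) / 2)"
      using int[of "-2"] by simp
    fix z assume z: "z \<in> space M"
    \<comment> \<open>For each \<open>\<theta>\<close> the left-hand term is the average of
      \<open>b \<theta> + 2 * expectation (h \<theta>)\<close>, which is at most \<open>P\<close>,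
      and of \<open>b \<theta> - 2 * h \<theta> z\<close>.\<close>
    show "(SUP \<theta>\<in>T. b \<theta> + (expectation (h \<theta>) - h \<theta> z)) \<le> (P + (SUP \<theta>\<in>T. b \<theta> - 2 * h \<theta> z)) / 2"
    proof (rule cSUP_least[OF T(2)])
      fix \<theta> assume \<theta>: "\<theta> \<in> T"
      have "b \<theta> - 2 * h \<theta> z \<le> (SUP \<theta>\<in>T. b \<theta> - 2 * h \<theta> z)"
        using bdd[OF z, of "-2"] by (intro cSUP_upper \<theta>) simp
      then show "b \<theta> + (expectation (h \<theta>) - h \<theta> z) \<le> (P + (SUP \<theta>\<in>T. b \<theta> - 2 * h \<theta> z)) / 2"
        using P[OF \<theta>] by (simp add: field_simps)
    qed
  qed
  also have "\<dots> = (P + (\<integral>z. (SUP \<theta>\<in>T. b \<theta> - 2 * h \<theta> z) \<partial>M)) / 2"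
    using int[of "-2"] by (simp add: prob_space)
  finally show ?thesis unfolding P_def .
qed

text \<open>The coordinates are symmetrized one after the other. A coordinate that already carries
  its sign \<open>s\<close> adds \<open>2 * s * h \<theta> z\<close> to the remaining sum; the
  arbitrary bounded offset \<open>a\<close> is there to absorb this term in the induction.\<close>

lemma (in prob_space) symmetrization:
  fixes h :: "'t \<Rightarrow> 'a \<Rightarrow> real"
  assumes T: "countable T" "T \<noteq> {}"
    and h: "\<And>\<theta>. \<theta> \<in> T \<Longrightarrow> h \<theta> \<in> borel_measurable M"
    and H: "\<And>\<theta> z. \<theta> \<in> T \<Longrightarrow> z \<in> space M \<Longrightarrow> \<bar>h \<theta> z\<bar> \<le> H"
    and I: "finite (I :: 'i set)" and a: "\<And>\<theta>. \<theta> \<in> T \<Longrightarrow> \<bar>a \<theta>\<bar> \<le> A"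
  shows "(\<integral>S. (SUP \<theta>\<in>T. a \<theta> + (\<Sum>i\<in>I. expectation (h \<theta>) - h \<theta> (S i))) \<partial>(PiM I (\<lambda>_. M)))
    \<le> measure_pmf.expectation (signs I)
        (\<lambda>\<epsilon>. \<integral>S. (SUP \<theta>\<in>T. a \<theta> + (\<Sum>i\<in>I. 2 * \<epsilon> i * h \<theta> (S i))) \<partial>(PiM I (\<lambda>_. M)))"
  using I a
proof (induction I arbitrary: a A rule: finite_induct)
  case empty
  then show ?case by simp
next
  case (insert i I)
  note PM = prob_space_axioms
  have PI: "prob_space (PiM I (\<lambda>_. M))" by (rule prob_space_PiM) (rule PM)
  interpret P: prob_space "PiM I (\<lambda>_. M)" by fact
  have inth: "integrable M (h \<theta>)" if "\<theta> \<in> T" for \<theta>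
    using H[OF that] h[OF that] by (intro integrable_const_bound[of _ H]) auto
  have H0: "\<bar>expectation (h \<theta>)\<bar> \<le> H" if "\<theta> \<in> T" for \<theta>
    using integral_le_const[OF inth[OF that], of H] integral_ge_const[OF inth[OF that], of "- H"] H[OF that]
    by (force simp: abs_le_iff)
  \<comment> \<open>The coefficients \<open>u\<close> of the expectations and \<open>v\<close> of
    the sample values cover the centred, the partly signed and the fully signed sums at once, so
    bounds and measurability are proved a single time.\<close>
  define W where "W J u v S = (SUP \<theta>\<in>T. a \<theta> + (\<Sum>j\<in>J. u j * expectation (h \<theta>) + v j * h \<theta> (S j)))"
    for J :: "'i set" and u v S
  have Wb: "\<bar>a \<theta> + (\<Sum>j\<in>J. u j * expectation (h \<theta>) + v j * h \<theta> (S j))\<bar>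
      \<le> A + (\<Sum>j\<in>J. (\<bar>u j\<bar> + \<bar>v j\<bar>) * H)"
    if "\<theta> \<in> T" "S \<in> space (PiM J (\<lambda>_. M))" for J :: "'i set" and u v S \<theta>
  proof -
    have "\<bar>u j * expectation (h \<theta>) + v j * h \<theta> (S j)\<bar> \<le> (\<bar>u j\<bar> + \<bar>v j\<bar>) * H" if "j \<in> J" for j
    proof -
      have "S j \<in> space M" using \<open>S \<in> _\<close> that by (auto simp: space_PiM)
      then have "\<bar>u j\<bar> * \<bar>expectation (h \<theta>)\<bar> \<le> \<bar>u j\<bar> * H" "\<bar>v j\<bar> * \<bar>h \<theta> (S j)\<bar> \<le> \<bar>v j\<bar> * H"
        using H0 H \<open>\<theta> \<in> T\<close> by (auto intro!: mult_left_mono)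
      then show ?thesis
        using abs_triangle_ineq[of "u j * expectation (h \<theta>)" "v j * h \<theta> (S j)"] by (simp add: abs_mult algebra_simps)
    qed
    then have "\<bar>\<Sum>j\<in>J. u j * expectation (h \<theta>) + v j * h \<theta> (S j)\<bar> \<le> (\<Sum>j\<in>J. (\<bar>u j\<bar> + \<bar>v j\<bar>) * H)"
      by (intro order_trans[OF sum_abs] sum_mono)
    then show ?thesis using insert.prems[OF that(1)] by linarith
  qed
  have Wm: "W J u v \<in> borel_measurable (PiM J (\<lambda>_. M))" for J :: "'i set" and u v
    unfolding W_def
  proof (intro borel_measurable_cSUP T)
    show "bdd_above ((\<lambda>\<theta>. a \<theta> + (\<Sum>j\<in>J. u j * expectation (h \<theta>) + v j * h \<theta> (x j))) ` T)"
      if "x \<in> space (PiM J (\<lambda>_. M))" for x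
      by (rule bdd_above_abs_bound[OF Wb]) (use that in auto)
    show "(\<lambda>x. a \<theta> + (\<Sum>j\<in>J. u j * expectation (h \<theta>) + v j * h \<theta> (x j))) \<in> borel_measurable (PiM J (\<lambda>_. M))"
      if "\<theta> \<in> T" for \<theta>
      using h[OF that] by measurable
  qed
  have Wbd: "\<bar>W J u v S\<bar> \<le> A + (\<Sum>j\<in>J. (\<bar>u j\<bar> + \<bar>v j\<bar>) * H)"
    if "S \<in> space (PiM J (\<lambda>_. M))" for J :: "'i set" and u v S
    unfolding W_def using Wb[OF _ that] by (intro abs_cSUP_le T) auto
  note W_insert = bounded_integral_PiM_insert[OF insert.hyps(1,2) PM Wm Wbd]
  have Wupd: "W (insert i I) u v (S(i := z))
      = (SUP \<theta>\<in>T. a \<theta> + (\<Sum>j\<in>I. u j * expectation (h \<theta>) + v j * h \<theta> (S j)) + (u i * expectation (h \<theta>) + v i * h \<theta> z))"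
    for u v S z
  proof -
    have "(\<Sum>j\<in>I. u j * expectation (h \<theta>) + v j * h \<theta> ((S(i := z)) j))
        = (\<Sum>j\<in>I. u j * expectation (h \<theta>) + v j * h \<theta> (S j))" for \<theta>
      using insert.hyps by (intro sum.cong) auto
    then show ?thesis unfolding W_def using insert.hyps by (simp add: add_ac)
  qed
  \<comment> \<open>With these coefficients the coordinate \<open>i\<close> is signed by
    \<open>s\<close>, while all others are still centred.\<close>
  define u where "u = (\<lambda>j::'i. if j = i then 0 else 1 :: real)"
  define v where "v s = (\<lambda>j::'i. if j = i then 2 * s else - 1 :: real)" for s
  let ?Q = "PiM I (\<lambda>_. M)" and ?QI = "PiM (insert i I) (\<lambda>_. M)"
  let ?R = "\<lambda>\<epsilon>. \<integral>S. (SUP \<theta>\<in>T. a \<theta> + (\<Sum>j\<in>insert i I. 2 * \<epsilon> j * h \<theta> (S j))) \<partial>?QI"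
  have Wuv: "W (insert i I) u (v s) (S(i := z))
      = (SUP \<theta>\<in>T. (a \<theta> + 2 * s * h \<theta> z) + (\<Sum>j\<in>I. expectation (h \<theta>) - h \<theta> (S j)))" for s S z
  proof -
    have "(\<Sum>j\<in>I. u j * expectation (h \<theta>) + v s j * h \<theta> (S j)) = (\<Sum>j\<in>I. expectation (h \<theta>) - h \<theta> (S j))" for \<theta>
      using insert.hyps by (intro sum.cong) (auto simp: u_def v_def)
    then show ?thesis unfolding Wupd by (simp add: u_def v_def add_ac)
  qed
  \<comment> \<open>With the coordinate \<open>i\<close> held at \<open>z\<close>, the induction
    hypothesis applies to the offset \<open>a \<theta> + 2 * s * h \<theta> z\<close>; integrating
    over \<open>z\<close> restores the full product.\<close>
  have step: "(\<integral>S. W (insert i I) u (v s) S \<partial>?QI)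
      \<le> measure_pmf.expectation (signs I) (\<lambda>\<epsilon>. ?R (\<epsilon>(i := s)))" if s: "\<bar>s\<bar> = 1" for s
  proof -
    let ?w = "\<lambda>\<epsilon>. W (insert i I) (\<lambda>_. 0) (\<lambda>j. 2 * (\<epsilon>(i := s)) j)"
    have w: "?w \<epsilon> (S(i := z)) = (SUP \<theta>\<in>T. (a \<theta> + 2 * s * h \<theta> z) + (\<Sum>j\<in>I. 2 * \<epsilon> j * h \<theta> (S j)))" for \<epsilon> S z
    proof -
      have "(\<Sum>j\<in>I. 0 * expectation (h \<theta>) + 2 * (\<epsilon>(i := s)) j * h \<theta> (S j)) = (\<Sum>j\<in>I. 2 * \<epsilon> j * h \<theta> (S j))" for \<theta>
        using insert.hyps by (intro sum.cong) auto
      then show ?thesis unfolding Wupd by (simp add: add_ac)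
    qed
    have IH: "(\<integral>S. W (insert i I) u (v s) (S(i := z)) \<partial>?Q)
        \<le> measure_pmf.expectation (signs I) (\<lambda>\<epsilon>. \<integral>S. ?w \<epsilon> (S(i := z)) \<partial>?Q)" if z: "z \<in> space M" for z
      unfolding w Wuv
    proof (rule insert.IH)
      fix \<theta> assume \<theta>: "\<theta> \<in> T"
      have "\<bar>2 * s * h \<theta> z\<bar> \<le> 2 * H" using H[OF \<theta> z] s by (simp add: abs_mult)
      then show "\<bar>a \<theta> + 2 * s * h \<theta> z\<bar> \<le> A + 2 * H" using insert.prems[OF \<theta>] by linarith
    qed
    have intw: "integrable M (\<lambda>z. \<integral>S. ?w \<epsilon> (S(i := z)) \<partial>?Q)" for \<epsilon>
      by (rule W_insert(4))
    have "(\<integral>S. W (insert i I) u (v s) S \<partial>?QI)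
        = (\<integral>z. \<integral>S. W (insert i I) u (v s) (S(i := z)) \<partial>?Q \<partial>M)"
      by (rule W_insert(2))
    also have "\<dots> \<le> (\<integral>z. measure_pmf.expectation (signs I) (\<lambda>\<epsilon>. \<integral>S. ?w \<epsilon> (S(i := z)) \<partial>?Q) \<partial>M)"
      by (intro integral_mono W_insert(4) integral_expectation_signs(1) insert.hyps intw IH)
    also have "\<dots> = measure_pmf.expectation (signs I) (\<lambda>\<epsilon>. \<integral>z. \<integral>S. ?w \<epsilon> (S(i := z)) \<partial>?Q \<partial>M)"
      by (intro integral_expectation_signs(2) insert.hyps intw)
    also have "\<dots> = measure_pmf.expectation (signs I) (\<lambda>\<epsilon>. \<integral>S. ?w \<epsilon> S \<partial>?QI)"
      by (intro Bochner_Integration.integral_cong refl W_insert(2)[symmetric])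
    finally show ?thesis by (simp add: W_def)
  qed
  \<comment> \<open>With the coordinates in \<open>I\<close> held fixed, their centred sum plays the
    role of the offset \<open>b\<close> in \<open>symmetrize_coordinate\<close>.\<close>
  have coord: "(\<integral>z. W (insert i I) (\<lambda>_. 1) (\<lambda>_. - 1) (S(i := z)) \<partial>M)
      \<le> ((\<integral>z. W (insert i I) u (v 1) (S(i := z)) \<partial>M)
        + (\<integral>z. W (insert i I) u (v (-1)) (S(i := z)) \<partial>M)) / 2"
    if S: "S \<in> space ?Q" for S
  proof -
    define b where "b \<theta> = a \<theta> + (\<Sum>j\<in>I. expectation (h \<theta>) - h \<theta> (S j))" for \<theta>
    have "\<bar>b \<theta>\<bar> \<le> A + (\<Sum>j\<in>I. 2 * H)" if "\<theta> \<in> T" for \<theta>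
      using Wb[OF that S, of "\<lambda>_. 1" "\<lambda>_. - 1"] by (simp add: b_def)
    from symmetrize_coordinate[OF T h H this]
    show ?thesis unfolding Wuv unfolding Wupd by (simp add: b_def algebra_simps)
  qed
  have "(\<integral>S. (SUP \<theta>\<in>T. a \<theta> + (\<Sum>i\<in>insert i I. expectation (h \<theta>) - h \<theta> (S i))) \<partial>?QI)
      = (\<integral>S. W (insert i I) (\<lambda>_. 1) (\<lambda>_. - 1) S \<partial>?QI)"
    by (simp add: W_def)
  also have "\<dots> = (\<integral>S. \<integral>z. W (insert i I) (\<lambda>_. 1) (\<lambda>_. - 1) (S(i := z)) \<partial>M \<partial>?Q)"
    by (rule W_insert(1))
  also have "\<dots> \<le> (\<integral>S. ((\<integral>z. W (insert i I) u (v 1) (S(i := z)) \<partial>M)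
        + (\<integral>z. W (insert i I) u (v (-1)) (S(i := z)) \<partial>M)) / 2 \<partial>?Q)"
    by (intro integral_mono coord Bochner_Integration.integrable_divide Bochner_Integration.integrable_add W_insert(3))
  also have "\<dots> = ((\<integral>S. W (insert i I) u (v 1) S \<partial>?QI)
        + (\<integral>S. W (insert i I) u (v (-1)) S \<partial>?QI)) / 2"
    using W_insert(3) by (simp add: W_insert(1))
  also have "\<dots> \<le> (measure_pmf.expectation (signs I) (\<lambda>\<epsilon>. ?R (\<epsilon>(i := 1)))
        + measure_pmf.expectation (signs I) (\<lambda>\<epsilon>. ?R (\<epsilon>(i := -1)))) / 2"
    using step[of 1] step[of "-1"] by simp
  also have "\<dots> = measure_pmf.expectation (signs (insert i I)) ?R"
    by (rule expectation_signs_insert[OF insert.hyps, symmetric])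
  finally show ?case .
qed

section \<open>Kernels and empirical frequencies of cells\<close>

text \<open>Rectangles form an intersection-stable generator, and on a rectangle the product measure
  is a finite product of functions that are measurable in \<open>x\<close>.\<close>

lemma measurable_PiM_kernel:
  assumes J: "finite J"
    and \<kappa>: "\<And>j. j \<in> J \<Longrightarrow> \<kappa> j \<in> L \<rightarrow>\<^sub>M prob_algebra N"
    and P: "\<And>j x. x \<in> space L \<Longrightarrow> prob_space (\<kappa> j x)"
  shows "(\<lambda>x. PiM J (\<lambda>j. \<kappa> j x)) \<in> L \<rightarrow>\<^sub>M prob_algebra (PiM J (\<lambda>_. N))"
proof (rule measurable_prob_algebra_generated)
  have sets_\<kappa>: "sets (\<kappa> j x) = sets N" if "j \<in> J" "x \<in> space L" for j x
    using measurable_space[OF \<kappa>[OF that(1)] that(2)] by (simp add: space_prob_algebra)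
  show "sets (PiM J (\<lambda>_. N)) = sigma_sets (\<Pi>\<^sub>E j\<in>J. space N) (prod_algebra J (\<lambda>_. N))"
    by (rule sets_PiM)
  show "Int_stable (prod_algebra J (\<lambda>_. N))" by (rule Int_stable_prod_algebra)
  show "prod_algebra J (\<lambda>_. N) \<subseteq> Pow (\<Pi>\<^sub>E j\<in>J. space N)" by (rule prod_algebra_sets_into_space)
  show "prob_space (PiM J (\<lambda>j. \<kappa> j x))" if "x \<in> space L" for x
    by (rule prob_space_PiM) (rule P[OF that])
  show "sets (PiM J (\<lambda>j. \<kappa> j x)) = sets (PiM J (\<lambda>_. N))" if "x \<in> space L" for x
    by (rule sets_PiM_cong) (auto simp: sets_\<kappa> that)
  fix A assume "A \<in> prod_algebra J (\<lambda>_. N)"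
  then obtain X where A: "A = (\<Pi>\<^sub>E j\<in>J. X j)" and X: "\<And>j. j \<in> J \<Longrightarrow> X j \<in> sets N"
    using J by (auto simp: prod_algebra_eq_finite)
  have "emeasure (PiM J (\<lambda>j. \<kappa> j x)) A = (\<Prod>j\<in>J. emeasure (\<kappa> j x) (X j))" if "x \<in> space L" for x
  proof -
    interpret product_sigma_finite "\<lambda>j. \<kappa> j x"
      by (intro product_sigma_finite.intro prob_space_imp_sigma_finite P that)
    show ?thesis unfolding A using J X sets_\<kappa> that by (intro emeasure_PiM) auto
  qed
  moreover have "(\<lambda>x. \<Prod>j\<in>J. emeasure (\<kappa> j x) (X j)) \<in> borel_measurable L"
    by (intro borel_measurable_prod_ennreal measurable_emeasure_kernel[OF measurable_prob_algebraD[OF \<kappa>]] X)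
  ultimately show "(\<lambda>x. emeasure (PiM J (\<lambda>j. \<kappa> j x)) A) \<in> borel_measurable L"
    by (subst measurable_cong) auto
qed

lemma PiM_component_integral:
  fixes g :: "'a \<Rightarrow> real"
  assumes M: "\<And>i. prob_space (M i)" and i: "i \<in> I" and g: "g \<in> borel_measurable (M i)"
  shows "(\<integral>x. g (x i) \<partial>PiM I M) = (\<integral>y. g y \<partial>M i)"
proof -
  have "(\<integral>y. g y \<partial>M i) = (\<integral>y. g y \<partial>distr (PiM I M) (M i) (\<lambda>x. x i))"
    using distr_PiM_component[of I M i] M i by simp
  also have "\<dots> = (\<integral>x. g (x i) \<partial>PiM I M)"
    using i g by (intro integral_distr) auto
  finally show ?thesis by simp
qed

text \<open>The coordinates are independent but may have different laws, as augmentations of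
  different graphs do; the frequency therefore concentrates around the average of the probabilities.
  McDiarmid's inequality is applied to the frequency and to its negative, each coordinate changing
  it by at most \<open>1 / card J\<close>.\<close>

lemma frequency_deviation:
  fixes M :: "'i \<Rightarrow> 'a measure"
  assumes J: "finite J" "J \<noteq> {}" and M: "\<And>j. prob_space (M j)"
    and C: "\<And>j. C \<in> sets (M j)" and \<epsilon>: "\<epsilon> > 0"
  shows "measure (PiM J M) {T \<in> space (PiM J M).
      \<bar>(\<Sum>j\<in>J. indicator C (T j)) / real (card J) - (\<Sum>j\<in>J. measure (M j) C) / real (card J)\<bar> \<ge> \<epsilon>}
    \<le> 2 * exp (- 2 * \<epsilon>\<^sup>2 * real (card J))"
proof -
  interpret prob_space "PiM J M" by (rule prob_space_PiM) (rule M)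
  define F where "F T = (\<Sum>j\<in>J. indicator C (T j)) / real (card J)" for T :: "'i \<Rightarrow> 'a"
  define p where "p = (\<Sum>j\<in>J. measure (M j) C) / real (card J)"
  have n: "real (card J) > 0" using J by (simp add: card_gt_0_iff)
  have comp [measurable]: "(\<lambda>T. indicator C (T j) :: real) \<in> borel_measurable (PiM J M)" if "j \<in> J" for j
    using that C by (intro measurable_compose[OF measurable_component_singleton[OF that]] borel_measurable_indicator)
  have F [measurable]: "F \<in> borel_measurable (PiM J M)" unfolding F_def by measurable
  have int: "integrable (PiM J M) (\<lambda>T. indicator C (T j) :: real)" if "j \<in> J" for j
    using comp[OF that] by (intro integrable_const_bound[of _ 1]) auto
  have E: "(\<integral>T. F T \<partial>PiM J M) = p"
  proof -
    have "(\<integral>T. (\<Sum>j\<in>J. indicator C (T j)) \<partial>PiM J M) = (\<Sum>j\<in>J. measure (M j) C)"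
      using C PiM_component_integral[OF M, of _ J "indicator C"] int
      by (subst Bochner_Integration.integral_sum) auto
    then show ?thesis unfolding F_def p_def by simp
  qed
  have F01: "0 \<le> F T" "F T \<le> 1" for T
  proof -
    have "(\<Sum>j\<in>J. indicator C (T j)) \<le> (\<Sum>j\<in>J. 1 :: real)" by (intro sum_mono) (auto simp: indicator_def)
    then show "0 \<le> F T" "F T \<le> 1" using n by (auto simp: F_def sum_nonneg)
  qed
  have diff: "\<bar>F T - F (T(j := y))\<bar> \<le> 1 / real (card J)" if j: "j \<in> J" for T j y
  proof -
    have "(\<Sum>i\<in>J - {j}. indicator C ((T(j := y)) i)) = (\<Sum>i\<in>J - {j}. indicator C (T i) :: real)"
      by (rule sum.cong) auto
    then have "(\<Sum>i\<in>J. indicator C (T i)) - (\<Sum>i\<in>J. indicator C ((T(j := y)) i))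
        = (indicator C (T j) - indicator C y :: real)"
      by (simp add: sum.remove[OF J(1) j])
    then have "F T - F (T(j := y)) = (indicator C (T j) - indicator C y) / real (card J)"
      unfolding F_def by (simp add: diff_divide_distrib[symmetric])
    then show ?thesis using n by (auto simp: indicator_def)
  qed
  have V: "(\<Sum>j\<in>J. (1 / real (card J))\<^sup>2) = 1 / real (card J)"
    using n by (simp add: power2_eq_square)
  have sum_sq: "(\<Sum>j\<in>J. (1 / real (card J))\<^sup>2) > 0" unfolding V using n by simp
  have absF: "\<bar>F T\<bar> \<le> 1" "\<bar>- F T\<bar> \<le> 1" for T using F01[of T] by auto
  have diff': "\<bar>- F T - - F (T(j := y))\<bar> \<le> 1 / real (card J)" if j: "j \<in> J" for T j y
    using diff[OF j, of T y] by linarith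
  have mF: "(\<lambda>T. - F T) \<in> borel_measurable (PiM J M)" by measurable
  have "prob {T \<in> space (PiM J M). F T \<ge> (\<integral>T. F T \<partial>PiM J M) + \<epsilon>} \<le> exp (- 2 * \<epsilon>\<^sup>2 / (\<Sum>j\<in>J. (1 / real (card J))\<^sup>2))"
    by (rule mcdiarmid[OF J(1) M F absF(1) diff sum_sq \<epsilon>])
  then have up: "prob {T \<in> space (PiM J M). F T \<ge> p + \<epsilon>} \<le> exp (- 2 * \<epsilon>\<^sup>2 / (1 / real (card J)))"
    unfolding V E .
  have "prob {T \<in> space (PiM J M). - F T \<ge> (\<integral>T. - F T \<partial>PiM J M) + \<epsilon>} \<le> exp (- 2 * \<epsilon>\<^sup>2 / (\<Sum>j\<in>J. (1 / real (card J))\<^sup>2))"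
    by (rule mcdiarmid[OF J(1) M mF absF(2) diff' sum_sq \<epsilon>])
  then have lo: "prob {T \<in> space (PiM J M). - F T \<ge> - p + \<epsilon>} \<le> exp (- 2 * \<epsilon>\<^sup>2 / (1 / real (card J)))"
    unfolding V Bochner_Integration.integral_minus E .
  have "{T \<in> space (PiM J M). \<bar>F T - p\<bar> \<ge> \<epsilon>}
      = {T \<in> space (PiM J M). F T \<ge> p + \<epsilon>} \<union> {T \<in> space (PiM J M). - F T \<ge> - p + \<epsilon>}"
    by (auto simp: abs_if)
  then have "prob {T \<in> space (PiM J M). \<bar>F T - p\<bar> \<ge> \<epsilon>}
      \<le> prob {T \<in> space (PiM J M). F T \<ge> p + \<epsilon>} + prob {T \<in> space (PiM J M). - F T \<ge> - p + \<epsilon>}"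
    by (simp only:) (intro measure_Un_le; measurable)
  then show ?thesis using up lo unfolding F_def p_def by simp
qed

text \<open>A deterministic comparison: once the cell frequencies of \<open>T\<close> are close to
  their expected values, the bound holds for every \<open>g\<close> with small oscillation on cells,
  hence uniformly over a class of such functions. Replace \<open>g\<close> by \<open>g'\<close>,
  constant on the first \<open>k\<close> cells and zero on the rest. This costs
  \<open>\<eta>\<close> plus the expected tail mass (at most \<open>\<tau>\<close>) for the
  integrals, and \<open>\<eta>\<close> plus the empirical tail mass (at most
  \<open>\<tau> + \<epsilon>\<close>) for the sample. The averages of \<open>g'\<close> differ by at
  most \<open>k * \<epsilon>\<close>, since its values lie in the unit interval.\<close>

lemma cell_approximation:
  fixes M :: "'i \<Rightarrow> 'a measure" and g :: "'a \<Rightarrow> real" and c :: "'a \<Rightarrow> nat"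
  assumes J: "finite J" "J \<noteq> {}" and M: "\<And>j. prob_space (M j)"
    and g: "\<And>j. g \<in> borel_measurable (M j)" and g01: "\<And>w. g w \<in> {0..1}"
    and c: "\<And>j. c \<in> measurable (M j) (count_space UNIV)"
    and U: "\<And>j. space (M j) = UNIV"
    and osc: "\<And>w w'. c w = c w' \<Longrightarrow> \<bar>g w - g w'\<bar> \<le> \<eta>"
    and cells: "\<And>i. i < k \<Longrightarrow>
      \<bar>(\<Sum>j\<in>J. indicator {w. c w = i} (T j)) / real (card J) - (\<Sum>j\<in>J. measure (M j) {w. c w = i}) / real (card J)\<bar> \<le> \<epsilon>"
    and tail: "\<bar>(\<Sum>j\<in>J. indicator {w. k \<le> c w} (T j)) / real (card J) - (\<Sum>j\<in>J. measure (M j) {w. k \<le> c w}) / real (card J)\<bar> \<le> \<epsilon>"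
    and \<tau>: "(\<Sum>j\<in>J. measure (M j) {w. k \<le> c w}) / real (card J) \<le> \<tau>"
  shows "\<bar>(\<Sum>j\<in>J. g (T j)) / real (card J) - (\<Sum>j\<in>J. \<integral>w. g w \<partial>M j) / real (card J)\<bar>
    \<le> (real k + 1) * \<epsilon> + 2 * \<eta> + 2 * \<tau>"
proof -
  define r where "r = real (card J)"
  have r: "r > 0" using J by (simp add: card_gt_0_iff r_def)
  have \<eta>0: "0 \<le> \<eta>" using osc[of undefined undefined] by simp
  \<comment> \<open>For an empty cell the choice is arbitrary, but the value still lies in the unit
    interval, as \<open>v01\<close> requires.\<close>
  define v where "v i = g (SOME w. c w = i)" for i
  have v01: "0 \<le> v i" "v i \<le> 1" for i using g01 by (auto simp: v_def)
  have gv: "\<bar>g w - v (c w)\<bar> \<le> \<eta>" for w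
    unfolding v_def by (rule osc) (metis (mono_tags, lifting) someI)
  define g' where "g' w = (\<Sum>i<k. v i * indicator {w. c w = i} w)" for w
  have g': "g' w = (if c w < k then v (c w) else 0)" for w
  proof -
    have "g' w = (\<Sum>i<k. if c w = i then v i else 0)"
      unfolding g'_def by (intro sum.cong) (auto simp: indicator_def)
    then show ?thesis by (simp add: sum.delta')
  qed
  have gg': "\<bar>g w - g' w\<bar> \<le> \<eta> + indicator {w. k \<le> c w} w" for w
    using gv[of w] g01[of w] \<eta>0 by (auto simp: g' indicator_def)
  have setsM [measurable]: "{w. c w = i} \<in> sets (M j)" "{w. k \<le> c w} \<in> sets (M j)" for i j
  proof -
    have "c -` A \<inter> space (M j) \<in> sets (M j)" for A
      by (rule measurable_sets[OF c]) simp
    from this[of "{i}"] this[of "{k..}"]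
    show "{w. c w = i} \<in> sets (M j)" "{w. k \<le> c w} \<in> sets (M j)"
      by (simp_all add: U vimage_def)
  qed
  have 1: "\<bar>(\<Sum>j\<in>J. g (T j)) / r - (\<Sum>j\<in>J. g' (T j)) / r\<bar>
      \<le> \<eta> + (\<Sum>j\<in>J. indicator {w. k \<le> c w} (T j)) / r"
  proof -
    have "\<bar>\<Sum>j\<in>J. g (T j) - g' (T j)\<bar> \<le> (\<Sum>j\<in>J. \<eta> + indicator {w. k \<le> c w} (T j))"
      by (intro order_trans[OF sum_abs] sum_mono gg')
    then show ?thesis using r
      by (simp add: sum_subtractf sum.distrib r_def[symmetric] diff_divide_distrib[symmetric] field_simps)
  qed
  have intg: "integrable (M j) g" for j
  proof -
    interpret prob_space "M j" by (rule M)
    show ?thesis using g01 by (intro integrable_const_bound[of _ 1] g AE_I2) (auto simp: abs_le_iff)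
  qed
  have intI: "integrable (M j) (\<lambda>w. indicator A w :: real)" if "A \<in> sets (M j)" for A j
  proof -
    interpret prob_space "M j" by (rule M)
    show ?thesis using that by (intro integrable_const_bound[of _ 1]) auto
  qed
  have intg': "integrable (M j) g'" for j
    unfolding g'_def by (intro Bochner_Integration.integrable_sum integrable_mult_right intI setsM)
  have Eg': "(\<integral>w. g' w \<partial>M j) = (\<Sum>i<k. v i * measure (M j) {w. c w = i})" for j
    unfolding g'_def using intI[OF setsM(1)] by (subst Bochner_Integration.integral_sum) (auto simp: U)
  have 2: "\<bar>(\<Sum>j\<in>J. \<integral>w. g w \<partial>M j) / r - (\<Sum>j\<in>J. \<integral>w. g' w \<partial>M j) / r\<bar>
      \<le> \<eta> + (\<Sum>j\<in>J. measure (M j) {w. k \<le> c w}) / r"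
  proof -
    have "\<bar>(\<integral>w. g w \<partial>M j) - (\<integral>w. g' w \<partial>M j)\<bar> \<le> \<eta> + measure (M j) {w. k \<le> c w}" for j
    proof -
      interpret prob_space "M j" by (rule M)
      have "\<bar>(\<integral>w. g w \<partial>M j) - (\<integral>w. g' w \<partial>M j)\<bar> = \<bar>\<integral>w. g w - g' w \<partial>M j\<bar>"
        using intg intg' by simp
      also have "\<dots> \<le> (\<integral>w. \<bar>g w - g' w\<bar> \<partial>M j)" by (rule integral_abs_bound)
      also have "\<dots> \<le> (\<integral>w. \<eta> + indicator {w. k \<le> c w} w \<partial>M j)"
        using intg intg' intI[OF setsM(2)] by (intro integral_mono gg') auto
      also have "\<dots> = \<eta> + measure (M j) {w. k \<le> c w}"
        using intI[OF setsM(2)] prob_space by (simp add: U)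
      finally show ?thesis .
    qed
    then have "\<bar>\<Sum>j\<in>J. (\<integral>w. g w \<partial>M j) - (\<integral>w. g' w \<partial>M j)\<bar> \<le> (\<Sum>j\<in>J. \<eta> + measure (M j) {w. k \<le> c w})"
      by (intro order_trans[OF sum_abs] sum_mono)
    then show ?thesis using r
      by (simp add: sum_subtractf sum.distrib r_def[symmetric] diff_divide_distrib[symmetric] field_simps)
  qed
  have 3: "\<bar>(\<Sum>j\<in>J. g' (T j)) / r - (\<Sum>j\<in>J. \<integral>w. g' w \<partial>M j) / r\<bar> \<le> real k * \<epsilon>"
  proof -
    have "(\<Sum>j\<in>J. g' (T j)) / r = (\<Sum>i<k. v i * ((\<Sum>j\<in>J. indicator {w. c w = i} (T j)) / r))"
      unfolding g'_def by (subst sum.swap) (simp add: sum_divide_distrib sum_distrib_left)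
    moreover have "(\<Sum>j\<in>J. \<integral>w. g' w \<partial>M j) / r = (\<Sum>i<k. v i * ((\<Sum>j\<in>J. measure (M j) {w. c w = i}) / r))"
      unfolding Eg' by (subst sum.swap) (simp add: sum_divide_distrib sum_distrib_left)
    ultimately have "\<bar>(\<Sum>j\<in>J. g' (T j)) / r - (\<Sum>j\<in>J. \<integral>w. g' w \<partial>M j) / r\<bar>
        = \<bar>\<Sum>i<k. v i * ((\<Sum>j\<in>J. indicator {w. c w = i} (T j)) / r - (\<Sum>j\<in>J. measure (M j) {w. c w = i}) / r)\<bar>"
      by (simp add: sum_subtractf right_diff_distrib)
    also have "\<dots> \<le> (\<Sum>i<k. \<epsilon>)"
    proof (intro order_trans[OF sum_abs] sum_mono)
      fix i assume "i \<in> {..<k}"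
      then have "\<bar>(\<Sum>j\<in>J. indicator {w. c w = i} (T j)) / r - (\<Sum>j\<in>J. measure (M j) {w. c w = i}) / r\<bar> \<le> \<epsilon>"
        using cells by (simp add: r_def)
      then show "\<bar>v i * ((\<Sum>j\<in>J. indicator {w. c w = i} (T j)) / r - (\<Sum>j\<in>J. measure (M j) {w. c w = i}) / r)\<bar> \<le> \<epsilon>"
        using mult_mono[OF v01(2)[of i], of "\<bar>(\<Sum>j\<in>J. indicator {w. c w = i} (T j)) / r - (\<Sum>j\<in>J. measure (M j) {w. c w = i}) / r\<bar>" \<epsilon>] v01[of i]
        by (simp add: abs_mult)
    qed
    finally show ?thesis by simp
  qed
  show ?thesis using 1 2 3 tail \<tau> unfolding r_def[symmetric] by (simp add: algebra_simps abs_le_iff)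
qed

section \<open>Countable partitions and countable dense families\<close>

text \<open>A graph is assigned to the first point of a dense sequence within distance
  \<open>r / 2\<close>; two graphs with the same first point are closer than \<open>r\<close>. The
  label is encoded as well, because the loss is Lipschitz only between graphs of equal label. A
  single natural number as cell index lets the tail be written as
  \<open>k \<le> c w\<close>.\<close>

lemma countable_cells:
  fixes r :: real
  assumes "r > 0"
  obtains c :: "('g::{metric_space, second_countable_topology}) \<times> ('y::countable) \<Rightarrow> nat"
  where "c \<in> measurable (borel \<Otimes>\<^sub>M count_space UNIV) (count_space UNIV)"
    and "\<And>w w'. c w = c w' \<Longrightarrow> snd w = snd w' \<and> dist (fst w) (fst w') < r"
proof -
  obtain B :: "'g set" where B: "countable B" "\<And>X. open X \<Longrightarrow> X \<noteq> {} \<Longrightarrow> \<exists>b\<in>B. b \<in> X"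
    by (rule countable_dense_setE) blast
  define q where "q = from_nat_into B"
  have q: "\<exists>n. dist (q n) x < r / 2" for x
  proof -
    obtain b where "b \<in> B" "b \<in> ball x (r / 2)"
      using B(2)[of "ball x (r / 2)"] assms by (metis open_ball centre_in_ball empty_iff half_gt_zero)
    then show ?thesis
      using from_nat_into_surj[OF B(1)] unfolding q_def by (metis dist_commute mem_ball)
  qed
  define a where "a w = (LEAST n. dist (q n) (fst w) < r / 2)" for w :: "'g \<times> 'y"
  define c where "c w = prod_encode (a w, to_nat (snd w))" for w :: "'g \<times> 'y"
  have [measurable]: "a \<in> measurable (borel \<Otimes>\<^sub>M count_space UNIV) (count_space UNIV)"
    unfolding a_def by measurable
  have [measurable]: "(\<lambda>w :: 'g \<times> 'y. to_nat (snd w)) \<in> measurable (borel \<Otimes>\<^sub>M count_space UNIV) (count_space UNIV)"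
    by measurable
  have "c \<in> measurable (borel \<Otimes>\<^sub>M count_space UNIV) (count_space UNIV)"
  proof (subst measurable_count_space_eq2_countable, safe)
    fix i :: nat
    have "c -` {i} \<inter> space (borel \<Otimes>\<^sub>M count_space UNIV)
      = {w \<in> space (borel \<Otimes>\<^sub>M count_space UNIV). a w = fst (prod_decode i) \<and> to_nat (snd w) = snd (prod_decode i)}"
      by (auto simp: c_def)
    also have "\<dots> \<in> sets (borel \<Otimes>\<^sub>M count_space UNIV)" by measurable
    finally show "c -` {i} \<inter> space (borel \<Otimes>\<^sub>M count_space UNIV) \<in> sets (borel \<Otimes>\<^sub>M count_space UNIV)" .
  qed auto
  moreover have "snd w = snd w' \<and> dist (fst w) (fst w') < r" if "c w = c w'" for w w'
  proof
    have "a w = a w'" "to_nat (snd w) = to_nat (snd w')" using that by (auto simp: c_def prod_encode_eq)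
    then show "snd w = snd w'" by simp
    have "dist (q (a w)) (fst w) < r / 2" for w :: "'g \<times> 'y"
      unfolding a_def by (rule LeastI_ex) (rule q)
    from this[of w] this[of w'] show "dist (fst w) (fst w') < r"
      using \<open>a w = a w'\<close> dist_triangle_half_l by (metis dist_commute)
  qed
  ultimately show ?thesis by (rule that)
qed

text \<open>A parameter is identified with the sequence of its values at the points
  \<open>Q n\<close>. Such sequences live in a countable product of real lines, where every subset
  has a countable dense subset; \<open>T\<close> picks one parameter for each of its members.
  Convergence in the product is convergence at each \<open>Q n\<close>, and the hypothesis on
  \<open>Q\<close>, being uniform in the parameter, extends it to every \<open>w\<close>.\<close>

lemma pointwise_dense_countable_subset:
  fixes F :: "'t \<Rightarrow> 'w \<Rightarrow> real" and Q :: "nat \<Rightarrow> 'w"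
  assumes ne: "\<Theta> \<noteq> {}"
    and Q: "\<And>w e. e > 0 \<Longrightarrow> \<exists>n. \<forall>\<theta>\<in>\<Theta>. \<bar>F \<theta> w - F \<theta> (Q n)\<bar> < e"
  obtains T where "countable T" "T \<noteq> {}" "T \<subseteq> \<Theta>"
    "\<And>\<theta>. \<theta> \<in> \<Theta> \<Longrightarrow> \<exists>s. (\<forall>k. s k \<in> T) \<and> (\<forall>w. (\<lambda>k. F (s k) w) \<longlonglongrightarrow> F \<theta> w)"
proof -
  define \<phi> where "\<phi> \<theta> = (\<lambda>n. F \<theta> (Q n))" for \<theta>
  obtain R where R: "countable R" "R \<subseteq> \<phi> ` \<Theta>" "\<phi> ` \<Theta> \<subseteq> closure R"
    by (rule separable[of "\<phi> ` \<Theta>"])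
  define T where "T = inv_into \<Theta> \<phi> ` R"
  have TR: "\<phi> (inv_into \<Theta> \<phi> x) = x" "inv_into \<Theta> \<phi> x \<in> \<Theta>" if "x \<in> R" for x
    using R(2) that by (auto intro: f_inv_into_f inv_into_into)
  show ?thesis
  proof (rule that[of T])
    show "countable T" using R(1) by (simp add: T_def)
    show "T \<noteq> {}" using R(3) ne by (auto simp: T_def)
    show "T \<subseteq> \<Theta>" using TR by (auto simp: T_def)
    fix \<theta> assume \<theta>: "\<theta> \<in> \<Theta>"
    then have "\<phi> \<theta> \<in> closure R" using R(3) by auto
    then obtain x where x: "\<And>k. x k \<in> R" "x \<longlonglongrightarrow> \<phi> \<theta>" unfolding closure_sequential by auto
    define s where "s k = inv_into \<Theta> \<phi> (x k)" for k
    have s: "s k \<in> T" "s k \<in> \<Theta>" "\<phi> (s k) = x k" for k using x(1) TR by (auto simp: s_def T_def)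
    have conv: "(\<lambda>k. F (s k) (Q n)) \<longlonglongrightarrow> F \<theta> (Q n)" for n
    proof -
      have "(\<lambda>k. x k n) \<longlonglongrightarrow> \<phi> \<theta> n"
        by (rule tendsto_compose[OF _ x(2), where g = "\<lambda>y. y n", simplified])
          (use continuous_on_product_coordinates[of n] in \<open>auto simp: continuous_on_def\<close>)
      moreover have "x k n = F (s k) (Q n)" for k unfolding s(3)[symmetric] \<phi>_def ..
      ultimately show ?thesis by (simp add: \<phi>_def)
    qed
    have "(\<lambda>k. F (s k) w) \<longlonglongrightarrow> F \<theta> w" for w
    proof (rule LIMSEQ_I)
      fix e :: real assume "e > 0"
      \<comment> \<open>The same \<open>n\<close> serves \<open>\<theta>\<close> and all
        \<open>s k\<close>, so each of the three parts of the estimate costs a third of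
        \<open>e\<close>.\<close>
      then obtain n where n: "\<forall>\<theta>\<in>\<Theta>. \<bar>F \<theta> w - F \<theta> (Q n)\<bar> < e / 3" using Q[of "e / 3" w] by auto
      obtain k0 where k0: "\<And>k. k \<ge> k0 \<Longrightarrow> \<bar>F (s k) (Q n) - F \<theta> (Q n)\<bar> < e / 3"
        using LIMSEQ_D[OF conv[of n], of "e / 3"] \<open>e > 0\<close> by auto
      have "norm (F (s k) w - F \<theta> w) < e" if "k \<ge> k0" for k
      proof -
        have "\<bar>F (s k) w - F (s k) (Q n)\<bar> < e / 3" "\<bar>F \<theta> w - F \<theta> (Q n)\<bar> < e / 3"
          using n s(2) \<theta> by auto
        then show ?thesis using k0[OF that] unfolding real_norm_def abs_less_iff by linarith
      qed
      then show "\<exists>no. \<forall>n\<ge>no. norm (F (s n) w - F \<theta> w) < e" by blast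
    qed
    then show "\<exists>s. (\<forall>k. s k \<in> T) \<and> (\<forall>w. (\<lambda>k. F (s k) w) \<longlonglongrightarrow> F \<theta> w)" using s(1) by blast
  qed
qed

section \<open>Arbitrary norms against the Euclidean norm\<close>

text \<open>The triangle inequality for \<open>x\<close> and its negative gives
  \<open>\<nu> 0 \<le> 2 * \<nu> x\<close>.\<close>

lemma is_norm_nonneg: "is_norm \<nu> \<Longrightarrow> 0 \<le> \<nu> x"
proof -
  assume n: "is_norm \<nu>"
  have "\<nu> 0 = 0" using n by (auto simp: is_norm_def)
  moreover have "\<nu> (x + (-1) *\<^sub>R x) \<le> \<nu> x + \<bar>-1\<bar> * \<nu> x"
    using n unfolding is_norm_def by metis
  ultimately show "0 \<le> \<nu> x" by simp
qed

text \<open>Expand in the standard basis and bound each coordinate by the Euclidean norm. This half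
  of the equivalence of norms turns a Lipschitz condition for \<open>\<nu>\<close> into a Euclidean
  one and makes \<open>\<nu>\<close> continuous.\<close>

lemma is_norm_le_norm:
  fixes \<nu> :: "'a::euclidean_space \<Rightarrow> real"
  assumes n: "is_norm \<nu>"
  obtains C where "C > 0" "\<And>x. \<nu> x \<le> C * norm x"
proof -
  have add: "\<nu> (x + y) \<le> \<nu> x + \<nu> y" and scale: "\<nu> (c *\<^sub>R x) = \<bar>c\<bar> * \<nu> x" and z: "\<nu> 0 = 0" for x y c
    using n by (auto simp: is_norm_def)
  note nonneg = is_norm_nonneg[OF n]
  have sumle: "\<nu> (\<Sum>b\<in>A. u b) \<le> (\<Sum>b\<in>A. \<nu> (u b))" if "finite A" for A and u :: "'a \<Rightarrow> 'a"
    using that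
  proof (induction A rule: finite_induct)
    case (insert b A)
    then show ?case using add[of "u b" "\<Sum>b\<in>A. u b"] by simp
  qed (simp add: z)
  \<comment> \<open>The summand 1 makes the constant positive from the nonnegativity of
    \<open>\<nu>\<close> alone.\<close>
  have "\<nu> x \<le> (1 + (\<Sum>b\<in>Basis. \<nu> b)) * norm x" for x
  proof -
    have "\<nu> x = \<nu> (\<Sum>b\<in>Basis. (x \<bullet> b) *\<^sub>R b)" by (simp add: euclidean_representation)
    also have "\<dots> \<le> (\<Sum>b\<in>Basis. \<bar>x \<bullet> b\<bar> * \<nu> b)"
      using sumle[OF finite_Basis, of "\<lambda>b. (x \<bullet> b) *\<^sub>R b"] by (simp add: scale)
    also have "\<dots> \<le> (\<Sum>b\<in>Basis. norm x * \<nu> b)"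
      by (intro sum_mono mult_right_mono Basis_le_norm nonneg)
    also have "\<dots> \<le> (1 + (\<Sum>b\<in>Basis. \<nu> b)) * norm x"
      by (simp add: sum_distrib_left[symmetric] algebra_simps)
    finally show ?thesis .
  qed
  moreover have "1 + (\<Sum>b\<in>(Basis::'a set). \<nu> b) > 0" using nonneg by (simp add: add_pos_nonneg sum_nonneg)
  ultimately show ?thesis by (rule that[rotated])
qed

lemma is_norm_measurable:
  fixes \<nu> :: "'a::euclidean_space \<Rightarrow> real"
  assumes n: "is_norm \<nu>"
  shows "\<nu> \<in> borel_measurable borel"
proof -
  obtain C where C: "C > 0" "\<And>x. \<nu> x \<le> C * norm x" using is_norm_le_norm[OF n] by blast
  have d: "\<nu> x - \<nu> y \<le> \<nu> (x - y)" for x y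
    using n unfolding is_norm_def by (metis diff_add_cancel diff_le_eq)
  have "\<bar>\<nu> x - \<nu> y\<bar> \<le> C * dist x y" for x y
    using d[of x y] d[of y x] C(2)[of "x - y"] C(2)[of "y - x"] by (simp add: dist_norm norm_minus_commute abs_le_iff)
  then have "C-lipschitz_on UNIV \<nu>" using C(1) by (intro lipschitz_onI) (auto simp: dist_real_def)
  then show ?thesis by (intro borel_measurable_continuous_onI lipschitz_on_continuous_on)
qed

section \<open>Empirical Rademacher complexity and the augmented loss\<close>

lemma rademacher_term_bound:
  fixes a :: "nat \<Rightarrow> 't \<Rightarrow> real"
  assumes "\<And>n \<theta>. n < N \<Longrightarrow> \<theta> \<in> T \<Longrightarrow> \<bar>a n \<theta>\<bar> \<le> 1"
    and "\<epsilon> \<in> set_pmf (signs {..<N})" "\<theta> \<in> T"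
  shows "\<bar>1 / real N * (\<Sum>n<N. \<epsilon> n * a n \<theta>)\<bar> \<le> 1"
proof -
  have "\<bar>\<Sum>n<N. \<epsilon> n * a n \<theta>\<bar> \<le> (\<Sum>n<N. 1)"
    using assms set_pmf_signsD[OF finite_lessThan assms(2)]
    by (intro order_trans[OF sum_abs] sum_mono) (simp add: abs_mult)
  \<comment> \<open>For \<open>N = 0\<close> the factor \<open>1 / real N\<close> is 0.\<close>
  then show ?thesis by (cases "N = 0") (simp_all add: abs_mult field_simps)
qed

lemma rademacher_bdd_above:
  fixes a :: "nat \<Rightarrow> 't \<Rightarrow> real"
  assumes "\<And>n \<theta>. n < N \<Longrightarrow> \<theta> \<in> T \<Longrightarrow> \<bar>a n \<theta>\<bar> \<le> 1"
    and "\<epsilon> \<in> set_pmf (signs {..<N})"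
  shows "bdd_above ((\<lambda>\<theta>. \<bar>1 / real N * (\<Sum>n<N. \<epsilon> n * a n \<theta>)\<bar>) ` T)"
proof (rule bdd_aboveI2)
  fix \<theta> assume "\<theta> \<in> T"
  then show "\<bar>1 / real N * (\<Sum>n<N. \<epsilon> n * a n \<theta>)\<bar> \<le> 1"
    using rademacher_term_bound[of N T a \<epsilon> \<theta>] assms by simp
qed

text \<open>A signed average moves by at most the average absolute change of the losses, whatever
  the signs. This one estimate yields the bounded differences of the complexity, its upper bound by
  1, and the comparison of the augmented with the original loss.\<close>

lemma rademacher_le_add:
  assumes T: "T \<noteq> {}"
    and b: "\<And>n \<theta>. n < N \<Longrightarrow> \<theta> \<in> T \<Longrightarrow> \<bar>b n \<theta>\<bar> \<le> 1"
    and c: "\<And>\<theta>. \<theta> \<in> T \<Longrightarrow> (\<Sum>n<N. \<bar>a n \<theta> - b n \<theta>\<bar>) / real N \<le> c"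
  shows "rademacher N T a \<le> rademacher N T b + c"
proof -
  have "rademacher N T a \<le> measure_pmf.expectation (signs {..<N})
      (\<lambda>\<epsilon>. (SUP \<theta>\<in>T. \<bar>1 / real N * (\<Sum>n<N. \<epsilon> n * b n \<theta>)\<bar>) + c)"
    unfolding rademacher_def
  proof (rule expectation_signs_mono[OF finite_lessThan])
    fix \<epsilon> assume \<epsilon>: "\<epsilon> \<in> set_pmf (signs {..<N})"
    show "(SUP \<theta>\<in>T. \<bar>1 / real N * (\<Sum>n<N. \<epsilon> n * a n \<theta>)\<bar>)
        \<le> (SUP \<theta>\<in>T. \<bar>1 / real N * (\<Sum>n<N. \<epsilon> n * b n \<theta>)\<bar>) + c"
    proof (rule cSUP_le_add[OF T])
      show "bdd_above ((\<lambda>\<theta>. \<bar>1 / real N * (\<Sum>n<N. \<epsilon> n * b n \<theta>)\<bar>) ` T)"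
        by (rule rademacher_bdd_above[OF b \<epsilon>])
      fix \<theta> assume \<theta>: "\<theta> \<in> T"
      have "\<bar>\<Sum>n<N. \<epsilon> n * (a n \<theta> - b n \<theta>)\<bar> \<le> (\<Sum>n<N. \<bar>a n \<theta> - b n \<theta>\<bar>)"
        using set_pmf_signsD[OF finite_lessThan \<epsilon>]
        by (intro order_trans[OF sum_abs] sum_mono) (simp add: abs_mult)
      then have "\<bar>\<Sum>n<N. \<epsilon> n * (a n \<theta> - b n \<theta>)\<bar> / real N \<le> (\<Sum>n<N. \<bar>a n \<theta> - b n \<theta>\<bar>) / real N"
        by (rule divide_right_mono) simp
      then have "\<bar>\<Sum>n<N. \<epsilon> n * (a n \<theta> - b n \<theta>)\<bar> / real N \<le> c" using c[OF \<theta>] by simp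
      moreover have "1 / real N * (\<Sum>n<N. \<epsilon> n * a n \<theta>)
          = 1 / real N * (\<Sum>n<N. \<epsilon> n * b n \<theta>) + (\<Sum>n<N. \<epsilon> n * (a n \<theta> - b n \<theta>)) / real N"
        by (simp add: right_diff_distrib sum_subtractf diff_divide_distrib)
      ultimately show "\<bar>1 / real N * (\<Sum>n<N. \<epsilon> n * a n \<theta>)\<bar> \<le> \<bar>1 / real N * (\<Sum>n<N. \<epsilon> n * b n \<theta>)\<bar> + c"
        using abs_triangle_ineq[of "1 / real N * (\<Sum>n<N. \<epsilon> n * b n \<theta>)" "(\<Sum>n<N. \<epsilon> n * (a n \<theta> - b n \<theta>)) / real N"]
        by simp
    qed
  qed
  also have "\<dots> = rademacher N T b + c"
    unfolding rademacher_def by (simp add: integrable_signs)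
  finally show ?thesis .
qed

text \<open>This returns from the countable subset of parameters, used for measurability, to the
  full set \<open>\<Theta>\<close>.\<close>

lemma rademacher_mono:
  assumes "T \<subseteq> \<Theta>" "T \<noteq> {}" and a: "\<And>n \<theta>. n < N \<Longrightarrow> \<theta> \<in> \<Theta> \<Longrightarrow> \<bar>a n \<theta>\<bar> \<le> 1"
  shows "rademacher N T a \<le> rademacher N \<Theta> a"
  unfolding rademacher_def
proof (rule expectation_signs_mono[OF finite_lessThan])
  fix \<epsilon> assume "\<epsilon> \<in> set_pmf (signs {..<N})"
  then show "(SUP \<theta>\<in>T. \<bar>1 / real N * (\<Sum>n<N. \<epsilon> n * a n \<theta>)\<bar>) \<le> (SUP \<theta>\<in>\<Theta>. \<bar>1 / real N * (\<Sum>n<N. \<epsilon> n * a n \<theta>)\<bar>)"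
    using assms(1,2) by (intro cSUP_subset_mono rademacher_bdd_above[OF a]) auto
qed

lemma rademacher_bounds:
  assumes T: "T \<noteq> {}" and a: "\<And>n \<theta>. n < N \<Longrightarrow> \<theta> \<in> T \<Longrightarrow> \<bar>a n \<theta>\<bar> \<le> 1"
  shows "0 \<le> rademacher N T a" "rademacher N T a \<le> 1"
proof -
  have z: "rademacher N T (\<lambda>_ _. 0) = 0" using T by (simp add: rademacher_def)
  obtain \<theta>0 where \<theta>0: "\<theta>0 \<in> T" using T by auto
  have "measure_pmf.expectation (signs {..<N}) (\<lambda>_. 0) \<le> rademacher N T a"
    unfolding rademacher_def
  proof (rule expectation_signs_mono[OF finite_lessThan])
    fix \<epsilon> assume "\<epsilon> \<in> set_pmf (signs {..<N})"
    then have "bdd_above ((\<lambda>\<theta>. \<bar>1 / real N * (\<Sum>n<N. \<epsilon> n * a n \<theta>)\<bar>) ` T)"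
      by (intro rademacher_bdd_above a)
    from cSUP_upper[OF \<theta>0 this] show "0 \<le> (SUP \<theta>\<in>T. \<bar>1 / real N * (\<Sum>n<N. \<epsilon> n * a n \<theta>)\<bar>)"
      by (rule order_trans[rotated]) simp
  qed
  then show "0 \<le> rademacher N T a" by simp
  have "(\<Sum>n<N. \<bar>a n \<theta>\<bar>) / real N \<le> 1" if "\<theta> \<in> T" for \<theta>
    using sum_mono[of "{..<N}" "\<lambda>n. \<bar>a n \<theta>\<bar>" "\<lambda>_. 1"] a[OF _ that]
    by (cases "N = 0") (auto simp: field_simps)
  \<comment> \<open>Comparison with the zero loss, whose complexity is 0.\<close>
  then have "rademacher N T a \<le> rademacher N T (\<lambda>_ _. 0) + 1"
    using T by (intro rademacher_le_add) auto
  then show "rademacher N T a \<le> 1" using z by simp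
qed

text \<open>\<open>Q\<close> has the shape of \<open>sample_measure\<close>: first \<open>x\<close>
  is drawn, then \<open>y\<close> from the kernel at \<open>x\<close>. Since \<open>B\<close> is
  likely conditionally on every \<open>x\<close>, integrating its conditional probability over
  \<open>A\<close> gives at least \<open>(1 - b) * prob A\<close>, hence at least
  \<open>prob A - b\<close>.\<close>

lemma (in prob_space) measure_dependent_event:
  assumes \<kappa>: "\<kappa> \<in> M \<rightarrow>\<^sub>M prob_algebra N"
    and A: "A \<in> sets M" "prob A \<ge> 1 - a"
    and B: "B \<in> sets (M \<Otimes>\<^sub>M N)" "\<And>x. x \<in> space M \<Longrightarrow> measure (\<kappa> x) {y \<in> space N. (x, y) \<in> B} \<ge> 1 - b"
    and b: "0 \<le> b" "b \<le> 1"
  defines "Q \<equiv> M \<bind> (\<lambda>x. distr (\<kappa> x) (M \<Otimes>\<^sub>M N) (\<lambda>y. (x, y)))"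
  shows "sets Q = sets (M \<Otimes>\<^sub>M N)" "measure Q (B \<inter> (A \<times> space N)) \<ge> 1 - a - b"
proof -
  let ?R = "M \<Otimes>\<^sub>M N" and ?E = "B \<inter> (A \<times> space N)"
  have M: "M \<in> space (prob_algebra M)" using prob_space_axioms by (simp add: space_prob_algebra)
  have k: "(\<lambda>x. distr (\<kappa> x) ?R (\<lambda>y. (x, y))) \<in> M \<rightarrow>\<^sub>M prob_algebra ?R"
    by (rule measurable_distr_prob_space2[OF \<kappa>]) simp
  show sQ: "sets Q = sets ?R" unfolding Q_def by (rule sets_bind'[OF M k])
  interpret Q: prob_space Q unfolding Q_def by (rule prob_space_bind'[OF M k])
  have E: "?E \<in> sets ?R" using A(1) B(1) by auto
  have "ennreal (1 - b) * emeasure M A = (\<integral>\<^sup>+x. ennreal (1 - b) * indicator A x \<partial>M)"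
    using A(1) by (simp add: nn_integral_cmult)
  also have "\<dots> \<le> (\<integral>\<^sup>+x. emeasure (distr (\<kappa> x) ?R (\<lambda>y. (x, y))) ?E \<partial>M)"
  proof (rule nn_integral_mono)
    fix x assume x: "x \<in> space M"
    have \<kappa>x: "prob_space (\<kappa> x)" "sets (\<kappa> x) = sets N"
      using measurable_space[OF \<kappa> x] by (auto simp: space_prob_algebra)
    interpret Kx: prob_space "\<kappa> x" by fact
    have sp: "space (\<kappa> x) = space N" using \<kappa>x(2) by (rule sets_eq_imp_space_eq)
    have pm: "Pair x \<in> measurable (\<kappa> x) ?R"
      using x measurable_Pair1'[OF x, of N] by (simp add: measurable_cong_sets[OF \<kappa>x(2) refl])
    show "ennreal (1 - b) * indicator A x \<le> emeasure (distr (\<kappa> x) ?R (\<lambda>y. (x, y))) ?E"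
    proof (cases "x \<in> A")
      case True
      then have "Pair x -` ?E \<inter> space (\<kappa> x) = {y \<in> space N. (x, y) \<in> B}" by (auto simp: sp)
      then show ?thesis
        using True B(2)[OF x] by (simp add: emeasure_distr[OF pm E] Kx.emeasure_eq_measure ennreal_leI)
    qed simp
  qed
  also have "\<dots> = emeasure Q ?E"
    unfolding Q_def by (rule emeasure_bind_prob_algebra[OF M k E, symmetric])
  finally have "(1 - b) * prob A \<le> measure Q ?E"
    using b by (simp add: emeasure_eq_measure Q.emeasure_eq_measure ennreal_mult[symmetric])
  moreover have "(1 - b) * prob A \<ge> prob A - b"
    using b prob_le_1[of A] mult_left_le[of "prob A" b] by (simp add: algebra_simps)
  ultimately show "measure Q ?E \<ge> 1 - a - b" using A(2) by linarith
qed

text \<open>Links the extended reals of the theorem with \<open>ennreal\<close>, where the bounds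
  are computed. Both take zero times infinity to be zero, which matters for \<open>L = 0\<close>
  with infinite displacement.\<close>

lemma ereal_times_enn2ereal: "0 \<le> c \<Longrightarrow> ereal c * enn2ereal x = enn2ereal (ennreal c * x)"
  by (simp add: times_ennreal.rep_eq enn2ereal_ennreal)

lemma space_lgraphs [simp]: "space lgraphs = UNIV"
  by (simp add: lgraphs_def space_pair_measure)

section \<open>Regularity of the losses and the cost of augmentation\<close>

locale graph_augmentation =
  fixes D :: "('n::finite, 'd::finite, 'y::countable) lgraph measure"
    and K :: "('n, 'd, 'y) lgraph \<Rightarrow> ('n, 'd, 'y) lgraph measure"
    and \<nu> :: "('n, 'd) graph \<Rightarrow> real"
    and f :: "('n, 'd) graph \<Rightarrow> 't \<Rightarrow> 'p"
    and l :: "'p \<Rightarrow> 'y \<Rightarrow> real"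
    and \<Theta> :: "'t set"
    and L :: real
  assumes prob_D: "prob_space D" and sets_D [measurable_cong]: "sets D = sets lgraphs"
    and K [measurable]: "K \<in> lgraphs \<rightarrow>\<^sub>M prob_algebra lgraphs"
    and norm_\<nu>: "is_norm \<nu>"
    and \<Theta>_ne: "\<Theta> \<noteq> {}"
    and l01: "\<And>p y. l p y \<in> {0..1}"
    and lip: "lipschitz_loss \<nu> L \<Theta> l f K"
begin

abbreviation "g \<equiv> gloss l f"
abbreviation "h \<equiv> aug_loss l f K"

sublocale D: prob_space D by (rule prob_D)

lemma space_D [simp]: "space D = UNIV"
  using sets_eq_imp_space_eq[OF sets_D] by simp

lemma prob_K: "prob_space (K z)" and sets_K [measurable_cong, simp]: "sets (K z) = sets lgraphs"
  using measurable_space[OF K, of z] by (auto simp: space_prob_algebra)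

lemma space_K [simp]: "space (K z) = UNIV"
  using sets_eq_imp_space_eq[OF sets_K] by simp

lemma L_nonneg: "0 \<le> L"
  using lip by (simp add: lipschitz_loss_def)

lemma g01: "0 \<le> g z \<theta>" "g z \<theta> \<le> 1"
  using l01 by (auto simp: gloss_def)

text \<open>The passage from \<open>\<nu>\<close> to the Euclidean distance makes the separability
  of the graph space usable, with one constant for all parameters.\<close>

lemma g_lipschitz:
  obtains C where "C \<ge> 0" "\<And>\<theta> G G' y. \<theta> \<in> \<Theta> \<Longrightarrow> \<bar>g (G', y) \<theta> - g (G, y) \<theta>\<bar> \<le> C * dist G' G"
proof -
  obtain C where C: "C > 0" "\<And>x. \<nu> x \<le> C * norm x" using is_norm_le_norm[OF norm_\<nu>] by blast
  have "\<bar>g (G', y) \<theta> - g (G, y) \<theta>\<bar> \<le> (L * C) * dist G' G" if "\<theta> \<in> \<Theta>" for \<theta> G G' y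
  proof -
    have "\<bar>g (G', y) \<theta> - g (G, y) \<theta>\<bar> \<le> L * \<nu> (G' - G)"
      using lip that unfolding lipschitz_loss_def by blast
    also have "\<dots> \<le> L * (C * norm (G' - G))" using C(2) L_nonneg by (intro mult_left_mono)
    finally show ?thesis by (simp add: dist_norm mult.assoc)
  qed
  moreover have "L * C \<ge> 0" using C L_nonneg by simp
  ultimately show ?thesis using that by blast
qed

text \<open>For each fixed label the loss is Lipschitz and hence Borel in the graph; countably many
  labels allow these functions to be glued.\<close>

lemma g_measurable [measurable]:
  assumes "\<theta> \<in> \<Theta>"
  shows "(\<lambda>z. g z \<theta>) \<in> borel_measurable lgraphs"
proof -
  obtain C where C: "C \<ge> 0" "\<And>\<theta> G G' y. \<theta> \<in> \<Theta> \<Longrightarrow> \<bar>g (G', y) \<theta> - g (G, y) \<theta>\<bar> \<le> C * dist G' G"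
    using g_lipschitz by blast
  have "C-lipschitz_on UNIV (\<lambda>G. g (G, y) \<theta>)" for y
    using C assms by (intro lipschitz_onI) (auto simp: dist_real_def)
  then have cont: "(\<lambda>G. g (G, y) \<theta>) \<in> borel_measurable borel" for y
    by (intro borel_measurable_continuous_onI lipschitz_on_continuous_on)
  have "(\<lambda>z. g (fst z, snd z) \<theta>) \<in> borel_measurable lgraphs"
    unfolding lgraphs_def
    by (rule measurable_compose_countable[where f = "\<lambda>y z. g (fst z, y) \<theta>"])
      (auto intro: measurable_compose[OF measurable_fst cont])
  then show ?thesis by simp
qed

lemma g_integrable:
  assumes "\<theta> \<in> \<Theta>"
  shows "integrable (K z) (\<lambda>w. g w \<theta>)" "integrable D (\<lambda>w. g w \<theta>)"
proof -
  interpret Kz: prob_space "K z" by (rule prob_K)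
  show "integrable (K z) (\<lambda>w. g w \<theta>)"
    using g01 assms by (intro Kz.integrable_const_bound[of _ 1]) auto
  show "integrable D (\<lambda>w. g w \<theta>)"
    using g01 assms by (intro D.integrable_const_bound[of _ 1]) auto
qed

lemma h01:
  assumes "\<theta> \<in> \<Theta>"
  shows "0 \<le> h z \<theta>" "h z \<theta> \<le> 1" "\<bar>h z \<theta>\<bar> \<le> 1"
proof -
  interpret Kz: prob_space "K z" by (rule prob_K)
  show "0 \<le> h z \<theta>" unfolding aug_loss_def by (simp add: g01)
  moreover show "h z \<theta> \<le> 1"
    unfolding aug_loss_def using g_integrable(1)[OF assms] g01 by (intro Kz.integral_le_const) auto
  ultimately show "\<bar>h z \<theta>\<bar> \<le> 1" by simp
qed

lemma h_measurable [measurable]: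
  assumes "\<theta> \<in> \<Theta>"
  shows "(\<lambda>z. h z \<theta>) \<in> borel_measurable lgraphs"
proof -
  have "(\<lambda>M. \<integral>w. g w \<theta> \<partial>M) \<in> borel_measurable (subprob_algebra lgraphs)"
    using assms by (intro integral_measurable_subprob_algebra) (auto simp: g01)
  then show ?thesis
    unfolding aug_loss_def by (rule measurable_compose[OF measurable_prob_algebraD[OF K]])
qed

lemma h_integrable: "\<theta> \<in> \<Theta> \<Longrightarrow> integrable D (\<lambda>z. h z \<theta>)"
  using h01 by (intro D.integrable_const_bound[of _ 1]) auto

lemma \<nu>_measurable [measurable]: "\<nu> \<in> borel_measurable borel"
  by (rule is_norm_measurable[OF norm_\<nu>])

lemma fst_measurable [measurable]: "fst \<in> lgraphs \<rightarrow>\<^sub>M borel"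
  by (simp add: lgraphs_def)

lemma displacement_measurable [measurable]: "displacement \<nu> K \<in> borel_measurable lgraphs"
  unfolding displacement_def[abs_def]
  by (rule nn_integral_measurable_subprob_algebra2[OF _ measurable_prob_algebraD[OF K]]) measurable

text \<open>Integrate the almost sure Lipschitz bound between a labelled graph and its
  augmentations. The right-hand side stays in \<open>ennreal\<close> because the expected
  displacement may be infinite.\<close>

lemma aug_loss_displacement:
  assumes \<theta>: "\<theta> \<in> \<Theta>"
  shows "ennreal \<bar>h z \<theta> - g z \<theta>\<bar> \<le> ennreal L * displacement \<nu> K z"
proof -
  interpret Kz: prob_space "K z" by (rule prob_K)
  note int = g_integrable(1)[OF \<theta>, of z]
  have "h z \<theta> - g z \<theta> = (\<integral>w. g w \<theta> - g z \<theta> \<partial>K z)"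
    using int Kz.prob_space by (simp add: aug_loss_def)
  then have "ennreal \<bar>h z \<theta> - g z \<theta>\<bar> \<le> ennreal (\<integral>w. \<bar>g w \<theta> - g z \<theta>\<bar> \<partial>K z)"
    by (intro ennreal_leI) (simp add: integral_abs_bound)
  also have "\<dots> = (\<integral>\<^sup>+w. ennreal \<bar>g w \<theta> - g z \<theta>\<bar> \<partial>K z)"
    using int by (intro nn_integral_eq_integral[symmetric]) auto
  also have "\<dots> \<le> (\<integral>\<^sup>+w. ennreal L * ennreal (\<nu> (fst w - fst z)) \<partial>K z)"
  proof (rule nn_integral_mono_AE)
    have "AE w in K (fst z, snd z). \<bar>g w \<theta> - g (fst z, snd z) \<theta>\<bar> \<le> L * \<nu> (fst w - fst z)"
      using lip \<theta> unfolding lipschitz_loss_def by blast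
    then have "AE w in K z. \<bar>g w \<theta> - g z \<theta>\<bar> \<le> L * \<nu> (fst w - fst z)"
      unfolding prod.collapse .
    then show "AE w in K z. ennreal \<bar>g w \<theta> - g z \<theta>\<bar> \<le> ennreal L * ennreal (\<nu> (fst w - fst z))"
      by eventually_elim (simp add: ennreal_mult[symmetric] L_nonneg is_norm_nonneg[OF norm_\<nu>] ennreal_leI)
  qed
  also have "\<dots> = ennreal L * displacement \<nu> K z"
    unfolding displacement_def by (rule nn_integral_cmult) measurable
  finally show ?thesis .
qed

lemma risk_displacement:
  assumes \<theta>: "\<theta> \<in> \<Theta>"
  shows "ennreal \<bar>(\<integral>z. g z \<theta> \<partial>D) - (\<integral>z. h z \<theta> \<partial>D)\<bar> \<le> ennreal L * (\<integral>\<^sup>+z. displacement \<nu> K z \<partial>D)"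
proof -
  note int = g_integrable(2)[OF \<theta>] h_integrable[OF \<theta>]
  have "ennreal \<bar>(\<integral>z. g z \<theta> \<partial>D) - (\<integral>z. h z \<theta> \<partial>D)\<bar> \<le> ennreal (\<integral>z. \<bar>h z \<theta> - g z \<theta>\<bar> \<partial>D)"
    using integral_abs_bound[of D "\<lambda>z. h z \<theta> - g z \<theta>"] int by (intro ennreal_leI) (simp add: abs_minus_commute)
  also have "\<dots> = (\<integral>\<^sup>+z. ennreal \<bar>h z \<theta> - g z \<theta>\<bar> \<partial>D)"
    using int by (intro nn_integral_eq_integral[symmetric]) auto
  also have "\<dots> \<le> (\<integral>\<^sup>+z. ennreal L * displacement \<nu> K z \<partial>D)"
    by (intro nn_integral_mono aug_loss_displacement \<theta>)
  also have "\<dots> = ennreal L * (\<integral>\<^sup>+z. displacement \<nu> K z \<partial>D)"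
    by (rule nn_integral_cmult) measurable
  finally show ?thesis .
qed

text \<open>Each loss changes by at most the largest displacement bound among the training graphs,
  so the average change does too, and \<open>rademacher_le_add\<close> applies. If that maximum is
  infinite, nothing is to be shown.\<close>

lemma rademacher_aug_le:
  assumes N: "N \<ge> 1"
  shows "ereal (rademacher N \<Theta> (\<lambda>n. h (S n)))
    \<le> ereal (rademacher N \<Theta> (\<lambda>n. g (S n))) + (MAX n\<in>{..<N}. ereal L * enn2ereal (displacement \<nu> K (S n)))"
proof -
  define m where "m = (MAX n\<in>{..<N}. ereal L * enn2ereal (displacement \<nu> K (S n)))"
  have m: "enn2ereal (ennreal L * displacement \<nu> K (S n)) \<le> m" if "n < N" for n
    unfolding m_def ereal_times_enn2ereal[OF L_nonneg] using that by (intro Max_ge) auto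
  \<comment> \<open>Nonnegativity excludes minus infinity in the case distinction on
    \<open>m\<close>; \<open>N \<ge> 1\<close> supplies an index for it.\<close>
  then have m0: "0 \<le> m" using m[of 0] N enn2ereal_nonneg order_trans by (metis less_eq_Suc_le One_nat_def)
  show ?thesis
  proof (cases m)
    case (real c)
    have hg: "\<bar>h (S n) \<theta> - g (S n) \<theta>\<bar> \<le> c" if "n < N" "\<theta> \<in> \<Theta>" for n \<theta>
    proof -
      have "enn2ereal (ennreal \<bar>h (S n) \<theta> - g (S n) \<theta>\<bar>) \<le> m"
        using aug_loss_displacement[OF that(2), of "S n"] m[OF that(1)]
        by (meson less_eq_ennreal.rep_eq order_trans)
      then show ?thesis by (simp add: real enn2ereal_ennreal)
    qed
    have "(\<Sum>n<N. \<bar>h (S n) \<theta> - g (S n) \<theta>\<bar>) / real N \<le> c" if "\<theta> \<in> \<Theta>" for \<theta>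
      using sum_mono[of "{..<N}" "\<lambda>n. \<bar>h (S n) \<theta> - g (S n) \<theta>\<bar>" "\<lambda>_. c"] hg[OF _ that] N
      by (simp add: field_simps)
    then have "rademacher N \<Theta> (\<lambda>n. h (S n)) \<le> rademacher N \<Theta> (\<lambda>n. g (S n)) + c"
      using g01 \<Theta>_ne by (intro rademacher_le_add) auto
    then show ?thesis unfolding m_def[symmetric] real by simp
  qed (use m0 in \<open>auto simp: m_def[symmetric]\<close>)
qed

end

lemma (in prob_space) prob_Int_ge:
  assumes [measurable]: "A \<in> events" "B \<in> events" and "prob A \<ge> 1 - a" "prob B \<ge> 1 - b"
  shows "prob (A \<inter> B) \<ge> 1 - a - b"
proof -
  have "prob (A - B) \<le> prob (space M - B)"
    using sets.sets_into_space[OF assms(1)] by (intro finite_measure_mono) auto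
  moreover have "prob (A - B) = prob A - prob (A \<inter> B)" by (rule finite_measure_Diff') measurable
  ultimately show ?thesis using assms(3,4) prob_compl[OF assms(2)] by simp
qed

lemma sum_fst_Times_avg:
  fixes q :: "nat \<Rightarrow> real"
  assumes "(M :: nat) > 0"
  shows "(\<Sum>j\<in>{..<N} \<times> {..<M}. q (fst j)) / real (card ({..<N} \<times> {..<M})) = (\<Sum>n<N. q n) / real N"
proof -
  have "(\<Sum>j\<in>{..<N} \<times> {..<M}. q (fst j)) = (\<Sum>n<N. \<Sum>m<M. q n)"
    unfolding sum.cartesian_product by (simp add: case_prod_unfold)
  also have "\<dots> = real M * (\<Sum>n<N. q n)" by (simp add: sum_distrib_left)
  finally show ?thesis using assms by simp
qed

section \<open>Concentration over the training sample\<close>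

context graph_augmentation
begin

definition aug_risk :: "'t \<Rightarrow> real" where
  "aug_risk \<theta> = (\<integral>z. h z \<theta> \<partial>D)"

text \<open>This uses the exact augmented loss of every training graph. For \<open>M > 0\<close> it
  is the conditional mean of \<open>aug_train_risk\<close> given the training set, and so separates
  the randomness of the training set from that of the augmentations.\<close>

definition emp_risk :: "nat \<Rightarrow> (nat \<Rightarrow> ('n, 'd, 'y) lgraph) \<Rightarrow> 't \<Rightarrow> real" where
  "emp_risk N S \<theta> = (\<Sum>n<N. h (S n) \<theta>) / real N"

lemma train_measure_eq: "train_measure D N = PiM {..<N} (\<lambda>_. D)"
  by (simp add: train_measure_def)

sublocale train: prob_space "train_measure D N" for N
  unfolding train_measure_eq by (rule prob_space_PiM) (rule prob_D)

lemma h_comp_measurable: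
  assumes "\<theta> \<in> \<Theta>" "n < N"
  shows "(\<lambda>S. h (S n) \<theta>) \<in> borel_measurable (train_measure D N)"
proof -
  have "(\<lambda>S. S n) \<in> train_measure D N \<rightarrow>\<^sub>M D"
    unfolding train_measure_eq using assms by (intro measurable_component_singleton) auto
  moreover have "(\<lambda>z. h z \<theta>) \<in> borel_measurable D" using assms by measurable
  ultimately show ?thesis by (rule measurable_compose)
qed

lemma emp_risk_measurable [measurable]:
  "\<theta> \<in> \<Theta> \<Longrightarrow> (\<lambda>S. emp_risk N S \<theta>) \<in> borel_measurable (train_measure D N)"
  unfolding emp_risk_def using h_comp_measurable by measurable

lemma emp_risk_bounds:
  assumes "\<theta> \<in> \<Theta>"
  shows "0 \<le> emp_risk N S \<theta>" "emp_risk N S \<theta> \<le> 1"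
proof -
  have "(\<Sum>n<N. h (S n) \<theta>) \<le> (\<Sum>n<N. 1)" by (intro sum_mono h01 assms)
  then show "0 \<le> emp_risk N S \<theta>" "emp_risk N S \<theta> \<le> 1"
    by (auto simp: emp_risk_def sum_nonneg h01[OF assms] divide_le_eq_1)
qed

lemma aug_risk_bounds:
  assumes "\<theta> \<in> \<Theta>"
  shows "0 \<le> aug_risk \<theta>" "aug_risk \<theta> \<le> 1"
  using h01[OF assms] h_integrable[OF assms] unfolding aug_risk_def
  by (auto intro!: D.integral_le_const)

lemma risk_gap_bound: "\<theta> \<in> \<Theta> \<Longrightarrow> \<bar>aug_risk \<theta> - emp_risk N S \<theta>\<bar> \<le> 1"
  using emp_risk_bounds[of \<theta> N S] aug_risk_bounds[of \<theta>] by (simp add: abs_le_iff)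

lemma h_abs_le: "T \<subseteq> \<Theta> \<Longrightarrow> \<theta> \<in> T \<Longrightarrow> \<bar>h z \<theta>\<bar> \<le> 1"
  by (rule h01(3)) (rule subsetD)

lemma rademacher_SUP_measurable:
  assumes T: "countable T" "T \<subseteq> \<Theta>" and \<epsilon>: "\<epsilon> \<in> set_pmf (signs {..<N})"
  shows "(\<lambda>S. SUP \<theta>\<in>T. \<bar>1 / real N * (\<Sum>n<N. \<epsilon> n * h (S n) \<theta>)\<bar>) \<in> borel_measurable (train_measure D N)"
proof (intro borel_measurable_cSUP T(1))
  show "(\<lambda>S. \<bar>1 / real N * (\<Sum>n<N. \<epsilon> n * h (S n) \<theta>)\<bar>) \<in> borel_measurable (train_measure D N)"
    if "\<theta> \<in> T" for \<theta>
  proof -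
    have "\<theta> \<in> \<Theta>" using T(2) that by auto
    then have [measurable]: "(\<lambda>S. h (S n) \<theta>) \<in> borel_measurable (train_measure D N)" if "n \<in> {..<N}" for n
      using h_comp_measurable that by auto
    show ?thesis by measurable
  qed
  show "bdd_above ((\<lambda>\<theta>. \<bar>1 / real N * (\<Sum>n<N. \<epsilon> n * h (S n) \<theta>)\<bar>) ` T)" for S
    by (rule rademacher_bdd_above[OF h_abs_le[OF T(2)] \<epsilon>])
qed

lemma rademacher_SUP_integrable:
  assumes T: "countable T" "T \<subseteq> \<Theta>" "T \<noteq> {}" and \<epsilon>: "\<epsilon> \<in> set_pmf (signs {..<N})"
  shows "integrable (train_measure D N) (\<lambda>S. SUP \<theta>\<in>T. \<bar>1 / real N * (\<Sum>n<N. \<epsilon> n * h (S n) \<theta>)\<bar>)"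
proof (rule train.integrable_const_bound)
  have "\<bar>\<bar>1 / real N * (\<Sum>n<N. \<epsilon> n * h (S n) \<theta>)\<bar>\<bar> \<le> 1" if "\<theta> \<in> T" for \<theta> S
    unfolding abs_idempotent
    by (rule rademacher_term_bound[where a = "\<lambda>n. h (S n)", OF h_abs_le[OF T(2)] \<epsilon> that])
  then show "AE S in train_measure D N. norm (SUP \<theta>\<in>T. \<bar>1 / real N * (\<Sum>n<N. \<epsilon> n * h (S n) \<theta>)\<bar>) \<le> 1"
    unfolding real_norm_def by (intro AE_I2 abs_cSUP_le T(3))
  show "(\<lambda>S. SUP \<theta>\<in>T. \<bar>1 / real N * (\<Sum>n<N. \<epsilon> n * h (S n) \<theta>)\<bar>) \<in> borel_measurable (train_measure D N)"
    by (rule rademacher_SUP_measurable[OF T(1,2) \<epsilon>])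
qed

lemma gap_SUP_measurable:
  assumes T: "countable T" "T \<subseteq> \<Theta>"
  shows "(\<lambda>S. SUP \<theta>\<in>T. aug_risk \<theta> - emp_risk N S \<theta>) \<in> borel_measurable (train_measure D N)"
proof (intro borel_measurable_cSUP T(1))
  show "(\<lambda>S. aug_risk \<theta> - emp_risk N S \<theta>) \<in> borel_measurable (train_measure D N)" if "\<theta> \<in> T" for \<theta>
  proof -
    have [measurable]: "\<theta> \<in> \<Theta>" using that T by auto
    show ?thesis by measurable
  qed
  show "bdd_above ((\<lambda>\<theta>. aug_risk \<theta> - emp_risk N S \<theta>) ` T)" for S
    by (rule bdd_above_abs_bound[OF risk_gap_bound]) (use T in auto)
qed

text \<open>Symmetrization with zero offset puts the factor \<open>2 * \<epsilon> n\<close> in front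
  of each loss; passing to absolute values then gives twice the Rademacher complexity.\<close>

lemma symmetrized_gap:
  assumes T: "countable T" "T \<subseteq> \<Theta>" "T \<noteq> {}"
  assumes N: "N \<ge> 1"
  shows "(\<integral>S. (SUP \<theta>\<in>T. aug_risk \<theta> - emp_risk N S \<theta>) \<partial>train_measure D N)
    \<le> 2 * (\<integral>S. rademacher N T (\<lambda>n. h (S n)) \<partial>train_measure D N)"
proof -
  let ?P = "train_measure D N"
  let ?R = "\<lambda>\<epsilon> S. SUP \<theta>\<in>T. \<bar>1 / real N * (\<Sum>n<N. \<epsilon> n * h (S n) \<theta>)\<bar>"
  \<comment> \<open>Dividing by \<open>real N\<close> turns the sample average into the plain sum
    treated by \<open>symmetrization\<close>.\<close>
  let ?H = "\<lambda>\<theta> z. h z \<theta> / real N"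
  have ET: "D.expectation (?H \<theta>) = aug_risk \<theta> / real N" for \<theta>
    by (simp add: aug_risk_def)
  have "(\<integral>S. (SUP \<theta>\<in>T. aug_risk \<theta> - emp_risk N S \<theta>) \<partial>?P)
      = (\<integral>S. (SUP \<theta>\<in>T. 0 + (\<Sum>n<N. D.expectation (?H \<theta>) - ?H \<theta> (S n))) \<partial>PiM {..<N} (\<lambda>_. D))"
    unfolding ET train_measure_eq using N
    by (intro Bochner_Integration.integral_cong SUP_cong refl)
      (simp add: emp_risk_def sum_subtractf sum_divide_distrib)
  also have "\<dots> \<le> measure_pmf.expectation (signs {..<N})
        (\<lambda>\<epsilon>. \<integral>S. (SUP \<theta>\<in>T. 0 + (\<Sum>n<N. 2 * \<epsilon> n * ?H \<theta> (S n))) \<partial>PiM {..<N} (\<lambda>_. D))"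
  proof (rule D.symmetrization[OF T(1,3), where H = 1 and A = 0])
    fix \<theta> assume "\<theta> \<in> T"
    then have \<theta> [measurable]: "\<theta> \<in> \<Theta>" using T by auto
    show "?H \<theta> \<in> borel_measurable D" by measurable
    show "\<bar>?H \<theta> z\<bar> \<le> 1" for z
      using h01(3)[OF \<theta>, of z] N by (simp add: divide_le_eq)
  qed auto
  also have "\<dots> \<le> measure_pmf.expectation (signs {..<N}) (\<lambda>\<epsilon>. \<integral>S. 2 * ?R \<epsilon> S \<partial>?P)"
  proof (rule expectation_signs_mono[OF finite_lessThan])
    fix \<epsilon> assume \<epsilon>: "\<epsilon> \<in> set_pmf (signs {..<N})"
    have le: "(SUP \<theta>\<in>T. 0 + (\<Sum>n<N. 2 * \<epsilon> n * ?H \<theta> (S n))) \<le> 2 * ?R \<epsilon> S" for S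
    proof (rule cSUP_least[OF T(3)])
      fix \<theta> assume \<theta>: "\<theta> \<in> T"
      have "0 + (\<Sum>n<N. 2 * \<epsilon> n * ?H \<theta> (S n)) = 2 * (1 / real N * (\<Sum>n<N. \<epsilon> n * h (S n) \<theta>))"
        by (simp add: sum_distrib_left mult.assoc)
      also have "\<dots> \<le> 2 * \<bar>1 / real N * (\<Sum>n<N. \<epsilon> n * h (S n) \<theta>)\<bar>" by linarith
      also have "\<dots> \<le> 2 * ?R \<epsilon> S"
        by (intro mult_left_mono cSUP_upper \<theta> rademacher_bdd_above[OF h_abs_le[OF T(2)] \<epsilon>]) auto
      finally show "0 + (\<Sum>n<N. 2 * \<epsilon> n * ?H \<theta> (S n)) \<le> 2 * ?R \<epsilon> S" .
    qed
    have int2: "integrable ?P (\<lambda>S. 2 * ?R \<epsilon> S)"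
      using rademacher_SUP_integrable[OF T \<epsilon>] by simp
    have bd: "\<bar>0 + (\<Sum>n<N. 2 * \<epsilon> n * ?H \<theta> (S n))\<bar> \<le> 2" if \<theta>: "\<theta> \<in> T" for \<theta> S
    proof -
      have "0 + (\<Sum>n<N. 2 * \<epsilon> n * ?H \<theta> (S n)) = 2 * (1 / real N * (\<Sum>n<N. \<epsilon> n * h (S n) \<theta>))"
        by (simp add: sum_distrib_left mult.assoc)
      then show ?thesis
        using rademacher_term_bound[where a = "\<lambda>n. h (S n)", OF h_abs_le[OF T(2)] \<epsilon> \<theta>] by linarith
    qed
    have "integrable ?P (\<lambda>S. SUP \<theta>\<in>T. 0 + (\<Sum>n<N. 2 * \<epsilon> n * ?H \<theta> (S n)))"
    proof (rule train.integrable_const_bound)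
      show "AE S in ?P. norm (SUP \<theta>\<in>T. 0 + (\<Sum>n<N. 2 * \<epsilon> n * ?H \<theta> (S n))) \<le> 2"
        unfolding real_norm_def by (intro AE_I2 abs_cSUP_le T(3) bd)
      show "(\<lambda>S. SUP \<theta>\<in>T. 0 + (\<Sum>n<N. 2 * \<epsilon> n * ?H \<theta> (S n))) \<in> borel_measurable ?P"
      proof (intro borel_measurable_cSUP T(1))
        fix \<theta> assume "\<theta> \<in> T"
        then have "\<theta> \<in> \<Theta>" using T by auto
        then have [measurable]: "(\<lambda>S. h (S n) \<theta>) \<in> borel_measurable ?P" if "n \<in> {..<N}" for n
          using h_comp_measurable that by auto
        show "(\<lambda>S. 0 + (\<Sum>n<N. 2 * \<epsilon> n * ?H \<theta> (S n))) \<in> borel_measurable ?P" by measurable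
      next
        show "bdd_above ((\<lambda>\<theta>. 0 + (\<Sum>n<N. 2 * \<epsilon> n * ?H \<theta> (S n))) ` T)" for S
          by (rule bdd_above_abs_bound[OF bd])
      qed
    qed
    then show "(\<integral>S. (SUP \<theta>\<in>T. 0 + (\<Sum>n<N. 2 * \<epsilon> n * ?H \<theta> (S n))) \<partial>PiM {..<N} (\<lambda>_. D))
        \<le> (\<integral>S. 2 * ?R \<epsilon> S \<partial>?P)"
      unfolding train_measure_eq[symmetric] by (intro integral_mono int2 le)
  qed
  also have "\<dots> = 2 * (\<integral>S. rademacher N T (\<lambda>n. h (S n)) \<partial>?P)"
    unfolding rademacher_def using rademacher_SUP_integrable[OF T]
    by (simp add: integral_expectation_signs(2)[OF finite_lessThan])
  finally show ?thesis .
qed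

text \<open>The theorem is stated with the complexity of the drawn sample, not with its mean.
  Subtracting it inside the statistic lets a single event control the uniform gap, the deviation at
  \<open>\<theta>0\<close> and the fluctuation of the complexity together.\<close>

definition gap_stat :: "'t set \<Rightarrow> 't \<Rightarrow> nat \<Rightarrow> (nat \<Rightarrow> ('n, 'd, 'y) lgraph) \<Rightarrow> real" where
  "gap_stat T \<theta>0 N S = (SUP \<theta>\<in>T. aug_risk \<theta> - emp_risk N S \<theta>)
     + (emp_risk N S \<theta>0 - aug_risk \<theta>0) - 2 * rademacher N T (\<lambda>n. h (S n))"

text \<open>The mean is at most 0 and each training graph changes the statistic by at most
  \<open>4 / N\<close>, so the squared differences add up to \<open>16 / N\<close> and McDiarmid's
  inequality gives the stated tail.\<close>

lemma gap_stat_deviation: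
  assumes T: "countable T" "T \<subseteq> \<Theta>" "T \<noteq> {}"
    and \<theta>0 [measurable]: "\<theta>0 \<in> \<Theta>" and N: "N \<ge> 1" and t: "t > 0"
  shows "gap_stat T \<theta>0 N \<in> borel_measurable (train_measure D N)"
    and "measure (train_measure D N) {S \<in> space (train_measure D N). gap_stat T \<theta>0 N S \<ge> t}
      \<le> exp (- (real N * t\<^sup>2 / 8))"
proof -
  let ?P = "train_measure D N"
  let ?R = "\<lambda>S. rademacher N T (\<lambda>n. h (S n))"
  let ?U = "\<lambda>S. SUP \<theta>\<in>T. aug_risk \<theta> - emp_risk N S \<theta>"
  have hT: "\<bar>h z \<theta>\<bar> \<le> 1" if "\<theta> \<in> T" for z \<theta> by (rule h_abs_le[OF T(2) that])
  have gapT: "\<bar>aug_risk \<theta> - emp_risk N S \<theta>\<bar> \<le> 1" if "\<theta> \<in> T" for S \<theta>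
    using risk_gap_bound T(2) that by auto
  have Rm [measurable]: "?R \<in> borel_measurable ?P"
    unfolding rademacher_def expectation_signs_eq_sum[OF finite_lessThan]
    by (intro borel_measurable_sum borel_measurable_times borel_measurable_const rademacher_SUP_measurable T)
  note Um [measurable] = gap_SUP_measurable[OF T(1,2), of N]
  show m: "gap_stat T \<theta>0 N \<in> borel_measurable ?P"
    unfolding gap_stat_def[abs_def] by measurable
  have U1: "\<bar>?U S\<bar> \<le> 1" for S by (rule abs_cSUP_le[OF T(3) gapT])
  have R01: "0 \<le> ?R S" "?R S \<le> 1" for S
    using rademacher_bounds[of T N "\<lambda>n. h (S n)"] T(3) hT by auto
  have bound: "\<bar>gap_stat T \<theta>0 N S\<bar> \<le> 4" for S
    using U1[of S] R01[of S] risk_gap_bound[OF \<theta>0, of N S] unfolding gap_stat_def by linarith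
  have intU: "integrable ?P ?U" and intR: "integrable ?P ?R"
    and intE: "integrable ?P (\<lambda>S. emp_risk N S \<theta>0)"
    using U1 R01 emp_risk_bounds[OF \<theta>0]
    by (auto intro!: train.integrable_const_bound[of _ 1] Um Rm)
  \<comment> \<open>The parameter \<open>\<theta>0\<close> does not depend on the sample, so its
    empirical risk is unbiased.\<close>
  have Eemp: "(\<integral>S. emp_risk N S \<theta>0 \<partial>?P) = aug_risk \<theta>0"
  proof -
    have int: "integrable ?P (\<lambda>S. h (S n) \<theta>0)" if "n < N" for n
      using h01[OF \<theta>0] h_comp_measurable[OF \<theta>0 that] by (intro train.integrable_const_bound[of _ 1]) auto
    have "(\<integral>S. h (S n) \<theta>0 \<partial>?P) = aug_risk \<theta>0" if "n < N" for n
      unfolding train_measure_eq aug_risk_def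
      using that by (intro PiM_component_integral[OF prob_D, where g = "\<lambda>z. h z \<theta>0"]) auto
    then show ?thesis using N int unfolding emp_risk_def
      by (simp add: Bochner_Integration.integral_sum)
  qed
  have E: "(\<integral>S. gap_stat T \<theta>0 N S \<partial>?P) \<le> 0"
  proof -
    have "(\<integral>S. gap_stat T \<theta>0 N S \<partial>?P) = (\<integral>S. ?U S \<partial>?P) + ((\<integral>S. emp_risk N S \<theta>0 \<partial>?P) - aug_risk \<theta>0) - 2 * (\<integral>S. ?R S \<partial>?P)"
      unfolding gap_stat_def using intU intR intE by (simp add: train.prob_space)
    then show ?thesis using symmetrized_gap[OF T N] Eemp by simp
  qed
  \<comment> \<open>The supremum and the risk at \<open>\<theta>0\<close> contribute
    \<open>1 / N\<close> each, the doubled complexity \<open>2 / N\<close>.\<close>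
  have diff: "\<bar>gap_stat T \<theta>0 N S - gap_stat T \<theta>0 N (S(i := y))\<bar> \<le> 4 / real N" if i: "i < N" for S i y
  proof -
    have one: "\<bar>h z \<theta> - h z' \<theta>\<bar> \<le> 1" if "\<theta> \<in> \<Theta>" for z z' \<theta>
      using h01(1,2)[OF that, of z] h01(1,2)[OF that, of z'] by (simp add: abs_le_iff)
    have single: "(\<Sum>n<N. \<bar>h (S n) \<theta> - h ((S(i := y)) n) \<theta>\<bar>) \<le> 1" if "\<theta> \<in> \<Theta>" for \<theta>
    proof -
      have "(\<Sum>n<N. \<bar>h (S n) \<theta> - h ((S(i := y)) n) \<theta>\<bar>) = (\<Sum>n<N. if n = i then \<bar>h (S n) \<theta> - h y \<theta>\<bar> else 0)"
        by (intro sum.cong) auto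
      then show ?thesis using i one[OF that] by simp
    qed
    have e: "\<bar>emp_risk N S \<theta> - emp_risk N (S(i := y)) \<theta>\<bar> \<le> 1 / real N" if "\<theta> \<in> \<Theta>" for \<theta>
    proof -
      have "\<bar>\<Sum>n<N. h (S n) \<theta> - h ((S(i := y)) n) \<theta>\<bar> \<le> 1"
        by (rule order_trans[OF sum_abs single[OF that]])
      moreover have "emp_risk N S \<theta> - emp_risk N (S(i := y)) \<theta> = (\<Sum>n<N. h (S n) \<theta> - h ((S(i := y)) n) \<theta>) / real N"
        unfolding emp_risk_def sum_subtractf by (rule diff_divide_distrib[symmetric])
      ultimately show ?thesis by (simp add: divide_right_mono)
    qed
    have "\<bar>?U S - ?U (S(i := y))\<bar> \<le> 1 / real N"
    proof (rule cSUP_diff_le[OF T(3)])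
      show "bdd_above ((\<lambda>\<theta>. aug_risk \<theta> - emp_risk N S \<theta>) ` T)"
        "bdd_above ((\<lambda>\<theta>. aug_risk \<theta> - emp_risk N (S(i := y)) \<theta>) ` T)"
        by (rule bdd_above_abs_bound[OF gapT], assumption)+
      show "\<bar>aug_risk \<theta> - emp_risk N S \<theta> - (aug_risk \<theta> - emp_risk N (S(i := y)) \<theta>)\<bar> \<le> 1 / real N" if "\<theta> \<in> T" for \<theta>
      proof -
        have "\<theta> \<in> \<Theta>" using that T(2) by auto
        from e[OF this] show ?thesis by linarith
      qed
    qed
    moreover have "\<bar>?R S - ?R (S(i := y))\<bar> \<le> 1 / real N"
    proof -
      have "(\<Sum>n<N. \<bar>h (S n) \<theta> - h ((S(i := y)) n) \<theta>\<bar>) / real N \<le> 1 / real N"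
        "(\<Sum>n<N. \<bar>h ((S(i := y)) n) \<theta> - h (S n) \<theta>\<bar>) / real N \<le> 1 / real N" if "\<theta> \<in> T" for \<theta>
      proof -
        have \<theta>: "\<theta> \<in> \<Theta>" using that T(2) by auto
        show "(\<Sum>n<N. \<bar>h (S n) \<theta> - h ((S(i := y)) n) \<theta>\<bar>) / real N \<le> 1 / real N"
          by (rule divide_right_mono[OF single[OF \<theta>]]) simp
        then show "(\<Sum>n<N. \<bar>h ((S(i := y)) n) \<theta> - h (S n) \<theta>\<bar>) / real N \<le> 1 / real N"
          by (subst abs_minus_commute)
      qed
      then have "?R S \<le> ?R (S(i := y)) + 1 / real N" "?R (S(i := y)) \<le> ?R S + 1 / real N"
        by (auto intro!: rademacher_le_add[OF T(3)] hT simp del: fun_upd_apply)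
      then show ?thesis by linarith
    qed
    moreover note e[OF \<theta>0]
    ultimately show ?thesis unfolding gap_stat_def by (simp add: abs_le_iff)
  qed
  have V: "(\<Sum>i<N. (4 / real N)\<^sup>2) = 16 / real N"
    using N by (simp add: power2_eq_square)
  have "measure (PiM {..<N} (\<lambda>_. D)) {S \<in> space (PiM {..<N} (\<lambda>_. D)).
        gap_stat T \<theta>0 N S \<ge> (\<integral>S. gap_stat T \<theta>0 N S \<partial>PiM {..<N} (\<lambda>_. D)) + t}
      \<le> exp (- 2 * t\<^sup>2 / (\<Sum>i<N. (4 / real N)\<^sup>2))"
  proof (rule mcdiarmid)
    show "gap_stat T \<theta>0 N \<in> borel_measurable (PiM {..<N} (\<lambda>_. D))" using m unfolding train_measure_eq .
    show "(\<Sum>i<N. (4 / real N)\<^sup>2) > 0" unfolding V using N by simp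
  qed (use prob_D bound diff t in auto)
  then have "measure ?P {S \<in> space ?P. gap_stat T \<theta>0 N S \<ge> (\<integral>S. gap_stat T \<theta>0 N S \<partial>?P) + t} \<le> exp (- (real N * t\<^sup>2 / 8))"
    unfolding V train_measure_eq by (simp add: mult.commute)
  \<comment> \<open>The mean being at most 0, exceeding \<open>t\<close> implies exceeding the mean
    by \<open>t\<close>.\<close>
  moreover have "measure ?P {S \<in> space ?P. gap_stat T \<theta>0 N S \<ge> t}
      \<le> measure ?P {S \<in> space ?P. gap_stat T \<theta>0 N S \<ge> (\<integral>S. gap_stat T \<theta>0 N S \<partial>?P) + t}"
    using E m by (intro train.finite_measure_mono) auto
  ultimately show "measure ?P {S \<in> space ?P. gap_stat T \<theta>0 N S \<ge> t} \<le> exp (- (real N * t\<^sup>2 / 8))"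
    by linarith
qed

section \<open>A countable set of parameters carrying the uniform gap\<close>

text \<open>One set \<open>T\<close> must serve every sample and every \<open>N\<close>, so density
  is required for pointwise convergence of the losses \<open>g\<close>. Dominated convergence, first
  under \<open>K z\<close> and then under \<open>D\<close>, carries the convergence over to
  \<open>h\<close> and to both risks.\<close>

lemma dense_parameters:
  obtains T where "countable T" "T \<noteq> {}" "T \<subseteq> \<Theta>"
    "\<And>\<theta> N S. \<theta> \<in> \<Theta> \<Longrightarrow> aug_risk \<theta> - emp_risk N S \<theta> \<le> (SUP \<theta>\<in>T. aug_risk \<theta> - emp_risk N S \<theta>)"
proof -
  obtain C where C: "C \<ge> 0" "\<And>\<theta> G G' y. \<theta> \<in> \<Theta> \<Longrightarrow> \<bar>g (G', y) \<theta> - g (G, y) \<theta>\<bar> \<le> C * dist G' G"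
    using g_lipschitz by blast
  obtain B :: "('n, 'd) graph set" where B: "countable B" "\<And>X. open X \<Longrightarrow> X \<noteq> {} \<Longrightarrow> \<exists>b\<in>B. b \<in> X"
    by (rule countable_dense_setE) blast
  define Q where "Q = from_nat_into (B \<times> (UNIV :: 'y set))"
  have Q: "\<exists>n. \<forall>\<theta>\<in>\<Theta>. \<bar>g w \<theta> - g (Q n) \<theta>\<bar> < e" if e: "e > 0" for w e
  proof -
    obtain G y where w: "w = (G, y)" by (cases w)
    \<comment> \<open>Using \<open>C + 1\<close> covers the case \<open>C = 0\<close>.\<close>
    have "e / (C + 1) > 0" using e C(1) by simp
    then have "ball G (e / (C + 1)) \<noteq> {}" by simp
    then obtain b where b: "b \<in> B" "b \<in> ball G (e / (C + 1))"
      using B(2)[OF open_ball] by blast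
    have "countable (B \<times> (UNIV :: 'y set))" using B(1) by auto
    then obtain n where n: "Q n = (b, y)"
      using b(1) from_nat_into_surj[of "B \<times> (UNIV :: 'y set)" "(b, y)"] by (auto simp: Q_def)
    have "\<bar>g w \<theta> - g (Q n) \<theta>\<bar> < e" if "\<theta> \<in> \<Theta>" for \<theta>
    proof -
      have "\<bar>g w \<theta> - g (Q n) \<theta>\<bar> \<le> C * dist G b" unfolding w n by (rule C(2)[OF that])
      also have "\<dots> \<le> (C + 1) * dist G b" by (simp add: algebra_simps)
      also have "\<dots> < e" using b(2) C(1) by (simp add: field_simps)
      finally show ?thesis .
    qed
    then show ?thesis by blast
  qed
  obtain T where T: "countable T" "T \<noteq> {}" "T \<subseteq> \<Theta>"
    and dense: "\<And>\<theta>. \<theta> \<in> \<Theta> \<Longrightarrow> \<exists>s. (\<forall>k. s k \<in> T) \<and> (\<forall>w. (\<lambda>k. g w (s k)) \<longlonglongrightarrow> g w \<theta>)"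
    using pointwise_dense_countable_subset[of \<Theta> "\<lambda>\<theta> w. g w \<theta>" Q] \<Theta>_ne Q by metis
  show ?thesis
  proof (rule that[OF T])
    fix \<theta> N S assume \<theta>: "\<theta> \<in> \<Theta>"
    obtain s where s: "\<And>k. s k \<in> T" "\<And>w. (\<lambda>k. g w (s k)) \<longlonglongrightarrow> g w \<theta>" using dense[OF \<theta>] by blast
    have s\<Theta>: "s k \<in> \<Theta>" for k using s(1) T(3) by auto
    have hlim: "(\<lambda>k. h z (s k)) \<longlonglongrightarrow> h z \<theta>" for z
      unfolding aug_loss_def
    proof (rule integral_dominated_convergence[where w = "\<lambda>_. 1"])
      interpret Kz: prob_space "K z" by (rule prob_K)
      show "integrable (K z) (\<lambda>_. 1 :: real)" by simp
      show "(\<lambda>w. g w \<theta>) \<in> borel_measurable (K z)" using \<theta> by measurable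
      show "(\<lambda>w. g w (s k)) \<in> borel_measurable (K z)" for k using s\<Theta>[of k] by measurable
    qed (use s(2) g01 in auto)
    have "(\<lambda>k. aug_risk (s k)) \<longlonglongrightarrow> aug_risk \<theta>"
      unfolding aug_risk_def
    proof (rule integral_dominated_convergence[where w = "\<lambda>_. 1"])
      show "integrable D (\<lambda>_. 1 :: real)" by simp
      show "(\<lambda>w. h w \<theta>) \<in> borel_measurable D" using \<theta> by measurable
      show "(\<lambda>w. h w (s k)) \<in> borel_measurable D" for k using s\<Theta>[of k] by measurable
    qed (use hlim h01(3)[OF s\<Theta>] in auto)
    moreover have "(\<lambda>k. emp_risk N S (s k)) \<longlonglongrightarrow> emp_risk N S \<theta>"
    proof -
      have "(\<lambda>k. (\<Sum>n<N. h (S n) (s k)) * (1 / real N)) \<longlonglongrightarrow> (\<Sum>n<N. h (S n) \<theta>) * (1 / real N)"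
        by (intro tendsto_mult_right tendsto_sum hlim)
      then show ?thesis by (simp add: emp_risk_def)
    qed
    ultimately have "(\<lambda>k. aug_risk (s k) - emp_risk N S (s k)) \<longlonglongrightarrow> aug_risk \<theta> - emp_risk N S \<theta>"
      by (rule tendsto_diff)
    moreover have "aug_risk (s k) - emp_risk N S (s k) \<le> (SUP \<theta>\<in>T. aug_risk \<theta> - emp_risk N S \<theta>)" for k
      by (intro cSUP_upper s(1) bdd_above_abs_bound[OF risk_gap_bound]) (use T(3) in auto)
    ultimately show "aug_risk \<theta> - emp_risk N S \<theta> \<le> (SUP \<theta>\<in>T. aug_risk \<theta> - emp_risk N S \<theta>)"
      by (intro LIMSEQ_le_const2) auto
  qed
qed

section \<open>The Monte Carlo error of finitely many augmentations\<close>

lemma aug_measure_eq: "aug_measure K N M S = PiM ({..<N} \<times> {..<M}) (\<lambda>j. K (S (fst j)))"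
  by (simp add: aug_measure_def case_prod_unfold)

lemma aug_measure_kernel:
  "aug_measure K N M \<in> train_measure D N \<rightarrow>\<^sub>M prob_algebra (PiM ({..<N} \<times> {..<M}) (\<lambda>_. D))"
proof -
  have "prob_algebra D = prob_algebra lgraphs"
    unfolding prob_algebra_def by (simp add: subprob_algebra_cong[OF sets_D])
  then have K': "K \<in> D \<rightarrow>\<^sub>M prob_algebra D"
    using K by (simp add: measurable_cong_sets[OF sets_D refl])
  have "(\<lambda>S. PiM ({..<N} \<times> {..<M}) (\<lambda>j. K (S (fst j))))
      \<in> train_measure D N \<rightarrow>\<^sub>M prob_algebra (PiM ({..<N} \<times> {..<M}) (\<lambda>_. D))"
  proof (rule measurable_PiM_kernel)
    show "(\<lambda>S. K (S (fst j))) \<in> train_measure D N \<rightarrow>\<^sub>M prob_algebra D" if "j \<in> {..<N} \<times> {..<M}" for j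
    proof -
      have "(\<lambda>S. S (fst j)) \<in> train_measure D N \<rightarrow>\<^sub>M D"
        unfolding train_measure_eq using that by (intro measurable_component_singleton) auto
      then show ?thesis by (rule measurable_compose[OF _ K'])
    qed
  qed (auto simp: prob_K)
  then show ?thesis by (simp add: aug_measure_eq[abs_def])
qed

lemma aug_train_risk_eq:
  "aug_train_risk l f N M T \<theta>
    = (\<Sum>j\<in>{..<N} \<times> {..<M}. g (T j) \<theta>) / real (card ({..<N} \<times> {..<M}))"
  by (simp add: aug_train_risk_def sum.cartesian_product case_prod_unfold)

lemma measure_component_measurable:
  assumes "C \<in> sets lgraphs" "n < N"
  shows "(\<lambda>S. measure (K (S n)) C) \<in> borel_measurable (train_measure D N)"
proof -
  have "(\<lambda>z. measure (K z) C) \<in> borel_measurable D"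
    using measurable_compose[OF K measurable_measure_prob_algebra[OF assms(1)]]
    by (simp add: measurable_cong_sets[OF sets_D refl])
  then show ?thesis
    unfolding train_measure_eq
    using assms(2) by (intro measurable_compose[OF measurable_component_singleton, where g = "\<lambda>z. measure (K z) C"]) auto
qed

text \<open>The event \<open>A\<close> does not depend on \<open>M\<close>: it says that on average
  over the training graphs the augmentation laws put little mass outside the first \<open>k\<close>
  cells. The event \<open>B\<close> says that the augmented graphs hit each cell, and the tail,
  about as often as expected; its conditional probability tends to 1 as \<open>M\<close> grows. On
  both, \<open>cell_approximation\<close> holds for all parameters at once.\<close>

lemma uniform_monte_carlo:
  assumes N: "N \<ge> 1" and t: "t > 0" and a: "a > 0"
  obtains A where "A \<in> sets (train_measure D N)" "measure (train_measure D N) A \<ge> 1 - a"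
    "\<forall>\<^sub>F M in sequentially. \<exists>B \<in> sets (train_measure D N \<Otimes>\<^sub>M PiM ({..<N} \<times> {..<M}) (\<lambda>_. D)).
      (\<forall>S\<in>space (train_measure D N).
        measure (aug_measure K N M S) {T \<in> space (PiM ({..<N} \<times> {..<M}) (\<lambda>_. D)). (S, T) \<in> B} \<ge> 1 - a) \<and>
      (\<forall>S T. S \<in> A \<longrightarrow> (S, T) \<in> B \<longrightarrow> (\<forall>\<theta>\<in>\<Theta>. \<bar>aug_train_risk l f N M T \<theta> - emp_risk N S \<theta>\<bar> \<le> t))"
proof -
  let ?P = "train_measure D N"
  obtain C where C: "C \<ge> 0" "\<And>\<theta> G G' y. \<theta> \<in> \<Theta> \<Longrightarrow> \<bar>g (G', y) \<theta> - g (G, y) \<theta>\<bar> \<le> C * dist G' G"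
    using g_lipschitz by blast
  \<comment> \<open>Chosen so that every loss oscillates by at most \<open>t / 8\<close> on a cell;
    \<open>C + 1\<close> covers \<open>C = 0\<close>.\<close>
  define r where "r = t / (8 * (C + 1))"
  have r: "r > 0" "C * r \<le> t / 8"
    using t C(1) by (auto simp: r_def field_simps)
  obtain c :: "('n, 'd, 'y) lgraph \<Rightarrow> nat"
    where c: "c \<in> measurable (borel \<Otimes>\<^sub>M count_space UNIV) (count_space UNIV)"
      and cell: "\<And>w w'. c w = c w' \<Longrightarrow> snd w = snd w' \<and> dist (fst w) (fst w') < r"
    using countable_cells[OF r(1)] by metis
  have c [measurable]: "c \<in> lgraphs \<rightarrow>\<^sub>M count_space UNIV" using c by (simp add: lgraphs_def)
  have osc: "\<bar>g w \<theta> - g w' \<theta>\<bar> \<le> t / 8" if "c w = c w'" "\<theta> \<in> \<Theta>" for w w' \<theta>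
  proof -
    obtain G y G' y' where w: "w = (G, y)" "w' = (G', y')" by (cases w; cases w')
    then have y: "y = y'" and d: "dist G G' < r" using cell[OF that(1)] by auto
    have "\<bar>g w \<theta> - g w' \<theta>\<bar> \<le> C * dist G G'" unfolding w y by (rule C(2)[OF that(2)])
    also have "\<dots> \<le> C * r" using d C(1) by (intro mult_left_mono) auto
    finally show ?thesis using r(2) by simp
  qed
  have sets_c [measurable]: "{w. c w = i} \<in> sets lgraphs" "{w. i \<le> c w} \<in> sets lgraphs" for i
  proof -
    have "c -` X \<inter> space lgraphs \<in> sets lgraphs" for X by (rule measurable_sets[OF c]) simp
    from this[of "{i}"] this[of "{i..}"]
    show "{w. c w = i} \<in> sets lgraphs" "{w. i \<le> c w} \<in> sets lgraphs" by (simp_all add: vimage_def)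
  qed
  have tail_meas: "(\<lambda>z. measure (K z) {w. k \<le> c w}) \<in> borel_measurable D" for k
    using measurable_compose[OF K measurable_measure_prob_algebra[OF sets_c(2)]]
    by (simp add: measurable_cong_sets[OF sets_D refl])
  \<comment> \<open>The tail vanishes for each \<open>z\<close> but not uniformly. Dominated
    convergence under \<open>D\<close> makes its mean smaller than \<open>(t / 8) * a\<close> for
    some \<open>k\<close>, and Markov's inequality at level \<open>t / 8\<close> then gives the
    failure probability \<open>a\<close>.\<close>
  have "(\<lambda>k. measure (K z) {w. k \<le> c w}) \<longlonglongrightarrow> 0" for z
  proof -
    interpret Kz: prob_space "K z" by (rule prob_K)
    have "(\<lambda>k. measure (K z) {w. k \<le> c w}) \<longlonglongrightarrow> measure (K z) (\<Inter>k. {w. k \<le> c w})"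
      by (rule Kz.finite_Lim_measure_decseq) (auto simp: decseq_def)
    moreover have "(\<Inter>k. {w. k \<le> c w}) = {}"
    proof (rule equals0I)
      fix w assume "w \<in> (\<Inter>k. {w. k \<le> c w})"
      then have "Suc (c w) \<le> c w" by blast
      then show False by simp
    qed
    ultimately show ?thesis by simp
  qed
  then have "(\<lambda>k. \<integral>z. measure (K z) {w. k \<le> c w} \<partial>D) \<longlonglongrightarrow> (\<integral>z. 0 \<partial>D)"
    using tail_meas prob_space.prob_le_1[OF prob_K]
    by (intro integral_dominated_convergence[where w = "\<lambda>_. 1"]) auto
  then have "\<forall>\<^sub>F k in sequentially. (\<integral>z. measure (K z) {w. k \<le> c w} \<partial>D) < (t / 8) * a"
    using t a by (intro order_tendstoD(2)) auto
  then obtain k where k: "(\<integral>z. measure (K z) {w. k \<le> c w} \<partial>D) < (t / 8) * a"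
    by (auto simp: eventually_sequentially)
  define tl where "tl S = (\<Sum>n<N. measure (K (S n)) {w. k \<le> c w}) / real N" for S
  have comp: "(\<lambda>S. measure (K (S n)) {w. k \<le> c w}) \<in> borel_measurable ?P" if "n < N" for n
    by (rule measure_component_measurable[OF sets_c(2) that])
  have int_comp: "integrable ?P (\<lambda>S. measure (K (S n)) {w. k \<le> c w})" if "n < N" for n
    using comp[OF that] prob_space.prob_le_1[OF prob_K] by (intro train.integrable_const_bound[of _ 1]) auto
  have tl_meas [measurable]: "tl \<in> borel_measurable ?P"
    unfolding tl_def[abs_def] using comp by measurable
  have int_tl: "integrable ?P tl"
    unfolding tl_def[abs_def]
    by (intro Bochner_Integration.integrable_divide Bochner_Integration.integrable_sum int_comp) simp
  have "(\<integral>S. tl S \<partial>?P) = (\<integral>z. measure (K z) {w. k \<le> c w} \<partial>D)"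
  proof -
    have "(\<integral>S. measure (K (S n)) {w. k \<le> c w} \<partial>?P) = (\<integral>z. measure (K z) {w. k \<le> c w} \<partial>D)" if "n < N" for n
      unfolding train_measure_eq
      using that tail_meas by (intro PiM_component_integral[OF prob_D, where g = "\<lambda>z. measure (K z) {w. k \<le> c w}"]) auto
    then show ?thesis using N int_comp unfolding tl_def by (simp add: Bochner_Integration.integral_sum)
  qed
  then have Etl: "(\<integral>S. tl S \<partial>?P) / (t / 8) \<le> a" using k t by (simp add: field_simps)
  have tl_nonneg: "0 \<le> tl S" for S by (simp add: tl_def sum_nonneg)
  define A where "A = {S \<in> space ?P. tl S < t / 8}"
  have A: "A \<in> sets ?P" unfolding A_def by measurable
  have "measure ?P {S \<in> space ?P. tl S \<ge> t / 8} \<le> (\<integral>S. tl S \<partial>?P) / (t / 8)"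
    by (rule integral_Markov_inequality_measure[where A = "space ?P"])
      (use int_tl t tl_nonneg in auto)
  moreover have "space ?P - A = {S \<in> space ?P. tl S \<ge> t / 8}" by (auto simp: A_def)
  ultimately have PA: "measure ?P A \<ge> 1 - a"
    using train.prob_compl[OF A] Etl by simp
  define \<epsilon> where "\<epsilon> = t / (4 * (real k + 1))"
  have \<epsilon>: "\<epsilon> > 0" "(real k + 1) * \<epsilon> = t / 4" using t by (auto simp: \<epsilon>_def field_simps)
  \<comment> \<open>Index \<open>k\<close> stands for the tail, so the \<open>k + 1\<close>
    frequencies are handled alike.\<close>
  define X where "X i = (if i < k then {w. c w = i} else {w. k \<le> c w})" for i
  have X [measurable]: "X i \<in> sets lgraphs" for i by (simp add: X_def sets_c)
  \<comment> \<open>A frequency is taken over \<open>N * M\<close> draws, so each of the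
    \<open>k + 1\<close> deviations fails with probability at most \<open>2 * q ^ M\<close>.\<close>
  define q where "q = exp (- 2 * \<epsilon>\<^sup>2 * real N)"
  have q: "0 \<le> q" "q < 1" using \<epsilon>(1) N by (auto simp: q_def)
  have "(\<lambda>M. (real k + 1) * (2 * q ^ M)) \<longlonglongrightarrow> (real k + 1) * (2 * 0)"
    using q by (intro tendsto_mult tendsto_const LIMSEQ_power_zero) auto
  then have evM: "\<forall>\<^sub>F M in sequentially. (real k + 1) * (2 * q ^ M) < a"
    using a by (intro order_tendstoD(2)) auto
  have "\<forall>\<^sub>F M in sequentially. \<exists>B \<in> sets (?P \<Otimes>\<^sub>M PiM ({..<N} \<times> {..<M}) (\<lambda>_. D)).
      (\<forall>S\<in>space ?P. measure (aug_measure K N M S) {T \<in> space (PiM ({..<N} \<times> {..<M}) (\<lambda>_. D)). (S, T) \<in> B} \<ge> 1 - a) \<and>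
      (\<forall>S T. S \<in> A \<longrightarrow> (S, T) \<in> B \<longrightarrow> (\<forall>\<theta>\<in>\<Theta>. \<bar>aug_train_risk l f N M T \<theta> - emp_risk N S \<theta>\<bar> \<le> t))"
    using evM eventually_gt_at_top[of 0]
  proof eventually_elim
    case (elim M)
    define J where "J = {..<N} \<times> {..<M}"
    let ?Q = "PiM J (\<lambda>_. D)"
    have J: "finite J" "J \<noteq> {}" and cardJ: "real (card J) = real N * real M"
      using N elim(2) by (auto simp: J_def lessThan_empty_iff)
    have avg: "(\<Sum>j\<in>J. p (fst j)) / real (card J) = (\<Sum>n<N. p n) / real N" for p :: "nat \<Rightarrow> real"
      unfolding J_def by (rule sum_fst_Times_avg[OF elim(2)])
    define dev where "dev i S T = \<bar>(\<Sum>j\<in>J. indicator (X i) (T j)) / real (card J)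
        - (\<Sum>j\<in>J. measure (K (S (fst j))) (X i)) / real (card J)\<bar>" for i S T
    define B where "B = {(S, T) \<in> space (?P \<Otimes>\<^sub>M ?Q). \<forall>i\<le>k. dev i S T < \<epsilon>}"
    have dev_meas: "(\<lambda>(S, T). dev i S T) \<in> borel_measurable (?P \<Otimes>\<^sub>M ?Q)" for i
    proof -
      have [measurable]: "(\<lambda>x. measure (K (fst x (fst j))) (X i)) \<in> borel_measurable (?P \<Otimes>\<^sub>M ?Q)" if "j \<in> J" for j
        using that by (intro measurable_compose[OF measurable_fst measure_component_measurable[OF X]]) (auto simp: J_def)
      have [measurable]: "(\<lambda>x. indicator (X i) (snd x j) :: real) \<in> borel_measurable (?P \<Otimes>\<^sub>M ?Q)" if "j \<in> J" for j
      proof -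
        have "(indicator (X i) :: _ \<Rightarrow> real) \<in> borel_measurable D"
          using X by (simp add: sets_D borel_measurable_indicator)
        then show ?thesis
          by (rule measurable_compose[OF measurable_compose[OF measurable_snd measurable_component_singleton[OF that]]])
      qed
      show ?thesis unfolding dev_def case_prod_unfold by measurable
    qed
    have B_sets: "B \<in> sets (?P \<Otimes>\<^sub>M ?Q)"
    proof -
      have "B = {x \<in> space (?P \<Otimes>\<^sub>M ?Q). \<forall>i\<in>{..k}. dev i (fst x) (snd x) < \<epsilon>}"
        by (auto simp: B_def)
      also have "\<dots> \<in> sets (?P \<Otimes>\<^sub>M ?Q)"
        using dev_meas[unfolded case_prod_unfold] by measurable
      finally show ?thesis .
    qed
    have B_prob: "measure (aug_measure K N M S) {T \<in> space ?Q. (S, T) \<in> B} \<ge> 1 - a" if S: "S \<in> space ?P" for S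
    proof -
      let ?\<mu> = "PiM J (\<lambda>j. K (S (fst j)))"
      interpret \<mu>: prob_space ?\<mu> by (rule prob_space_PiM) (rule prob_K)
      have sp: "space ?\<mu> = space ?Q" by (simp add: space_PiM)
      have dev_T [measurable]: "dev i S \<in> borel_measurable ?\<mu>" for i
      proof -
        have "(\<lambda>T. indicator (X i) (T j) :: real) \<in> borel_measurable ?\<mu>" if "j \<in> J" for j
          by (rule measurable_compose[OF measurable_component_singleton[OF that]])
            (simp add: borel_measurable_indicator X)
        then show ?thesis unfolding dev_def[abs_def] by measurable
      qed
      define F where "F i = {T \<in> space ?\<mu>. dev i S T \<ge> \<epsilon>}" for i
      have F: "F i \<in> sets ?\<mu>" for i unfolding F_def by measurable
      have Fp: "\<mu>.prob (F i) \<le> 2 * q ^ M" for i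
      proof -
        have "\<mu>.prob (F i) \<le> 2 * exp (- 2 * \<epsilon>\<^sup>2 * real (card J))"
          unfolding F_def dev_def by (rule frequency_deviation[OF J prob_K _ \<epsilon>(1)]) (simp add: X)
        also have "exp (- 2 * \<epsilon>\<^sup>2 * real (card J)) = q ^ M"
          unfolding q_def cardJ by (simp add: exp_of_nat_mult[symmetric] mult_ac)
        finally show ?thesis .
      qed
      have "\<mu>.prob (\<Union>i\<in>{..k}. F i) \<le> (\<Sum>i\<in>{..k}. \<mu>.prob (F i))"
        using F by (intro \<mu>.finite_measure_subadditive_finite) auto
      also have "\<dots> \<le> (\<Sum>i\<in>{..k}. 2 * q ^ M)" by (intro sum_mono Fp)
      also have "\<dots> < a" using elim(1) by (simp add: add.commute)
      finally have "\<mu>.prob (\<Union>i\<in>{..k}. F i) \<le> a" by simp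
      moreover have "\<mu>.prob (space ?\<mu> - (\<Union>i\<in>{..k}. F i)) = 1 - \<mu>.prob (\<Union>i\<in>{..k}. F i)"
        using F by (intro \<mu>.prob_compl) auto
      moreover have "space ?\<mu> - (\<Union>i\<in>{..k}. F i) = {T \<in> space ?Q. (S, T) \<in> B}"
        using S unfolding F_def sp by (auto simp: B_def space_pair_measure not_le)
      ultimately show ?thesis unfolding aug_measure_eq J_def by simp
    qed
    have B_good: "\<bar>aug_train_risk l f N M T \<theta> - emp_risk N S \<theta>\<bar> \<le> t"
      if SA: "S \<in> A" and ST: "(S, T) \<in> B" and \<theta>: "\<theta> \<in> \<Theta>" for S T \<theta>
    proof -
      have d: "dev i S T \<le> \<epsilon>" if "i \<le> k" for i using ST that by (auto simp: B_def less_imp_le)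
      have "\<bar>(\<Sum>j\<in>J. g (T j) \<theta>) / real (card J) - (\<Sum>j\<in>J. \<integral>w. g w \<theta> \<partial>K (S (fst j))) / real (card J)\<bar>
          \<le> (real k + 1) * \<epsilon> + 2 * (t / 8) + 2 * (t / 8)"
      proof (rule cell_approximation[OF J, where M = "\<lambda>j. K (S (fst j))" and g = "\<lambda>w. g w \<theta>" and c = c])
        show "(\<lambda>w. g w \<theta>) \<in> borel_measurable (K (S (fst j)))" for j using \<theta> by measurable
        show "c \<in> K (S (fst j)) \<rightarrow>\<^sub>M count_space UNIV" for j by measurable
        show "g w \<theta> \<in> {0..1}" for w using g01 by simp
        show "\<bar>(\<Sum>j\<in>J. indicator {w. c w = i} (T j)) / real (card J)
          - (\<Sum>j\<in>J. measure (K (S (fst j))) {w. c w = i}) / real (card J)\<bar> \<le> \<epsilon>" if "i < k" for i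
          using d[of i] that by (simp add: dev_def X_def)
        show "\<bar>(\<Sum>j\<in>J. indicator {w. k \<le> c w} (T j)) / real (card J)
          - (\<Sum>j\<in>J. measure (K (S (fst j))) {w. k \<le> c w}) / real (card J)\<bar> \<le> \<epsilon>"
          using d[of k] by (simp add: dev_def X_def)
        show "(\<Sum>j\<in>J. measure (K (S (fst j))) {w. k \<le> c w}) / real (card J) \<le> t / 8"
          using SA avg[of "\<lambda>n. measure (K (S n)) {w. k \<le> c w}"] by (simp add: A_def tl_def)
      qed (use osc \<theta> prob_K in auto)
      \<comment> \<open>Cells, oscillation and tail contribute \<open>t / 4\<close> each.\<close>
      also have "\<dots> \<le> t" using \<epsilon>(2) t by simp
      finally show ?thesis
        using avg[of "\<lambda>n. \<integral>w. g w \<theta> \<partial>K (S n)"]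
        by (simp add: aug_train_risk_eq emp_risk_def aug_loss_def J_def)
    qed
    show ?case using B_sets B_prob B_good unfolding J_def by blast
  qed
  then show ?thesis by (rule that[OF A PA])
qed

section \<open>Assembling the excess risk bound\<close>

text \<open>The deterministic part. From the risk of \<open>\<theta>a\<close> pass to its augmented
  risk (cost \<open>w\<close>), to its empirical risk (the supremum in \<open>gap_stat\<close>), to
  the sampled augmented risk (cost \<open>t\<close>), by minimality to that of
  \<open>\<theta>0\<close>, and back through empirical and augmented risk (again \<open>t\<close>
  and \<open>w\<close>). The gaps for \<open>\<theta>a\<close> and \<open>\<theta>0\<close> together
  cost \<open>2 * t\<close> plus twice the complexity, and the choice of \<open>\<theta>0\<close>
  costs the last \<open>t\<close>. This makes \<open>5 * t\<close> and \<open>2 * w\<close>.\<close>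

lemma excess_risk_le:
  assumes dense: "\<And>\<theta>. \<theta> \<in> \<Theta> \<Longrightarrow> aug_risk \<theta> - emp_risk N S \<theta> \<le> (SUP \<theta>\<in>T0. aug_risk \<theta> - emp_risk N S \<theta>)"
    and T0: "T0 \<noteq> {}" "T0 \<subseteq> \<Theta>"
    and \<theta>0: "\<theta>0 \<in> \<Theta>" "\<And>\<theta>. \<theta> \<in> \<Theta> \<Longrightarrow> (\<integral>z. g z \<theta>0 \<partial>D) \<le> (\<integral>z. g z \<theta> \<partial>D) + t"
    and stat: "gap_stat T0 \<theta>0 N S \<le> 2 * t"
    and mc: "\<And>\<theta>. \<theta> \<in> \<Theta> \<Longrightarrow> \<bar>aug_train_risk l f N M T \<theta> - emp_risk N S \<theta>\<bar> \<le> t"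
    and \<theta>s: "\<theta>s \<in> \<Theta>" and \<theta>a: "is_arg_min (aug_train_risk l f N M T) (\<lambda>\<theta>. \<theta> \<in> \<Theta>) \<theta>a"
  shows "ereal ((\<integral>z. g z \<theta>a \<partial>D) - (\<integral>z. g z \<theta>s \<partial>D))
    \<le> ereal (2 * rademacher N \<Theta> (\<lambda>n. h (S n)) + 5 * t)
      + ereal (2 * L) * enn2ereal (\<integral>\<^sup>+ z. displacement \<nu> K z \<partial>D)"
proof -
  define W where "W = ennreal L * (\<integral>\<^sup>+ z. displacement \<nu> K z \<partial>D)"
  have \<theta>a\<Theta>: "\<theta>a \<in> \<Theta>" and min: "aug_train_risk l f N M T \<theta>a \<le> aug_train_risk l f N M T \<theta>0"
    using \<theta>a \<theta>0(1) by (auto simp: is_arg_min_def not_less)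
  have LW: "ereal (2 * L) * enn2ereal (\<integral>\<^sup>+ z. displacement \<nu> K z \<partial>D) = enn2ereal (2 * W)"
    using L_nonneg by (simp add: ereal_times_enn2ereal W_def ennreal_mult mult.assoc)
  show ?thesis
  proof (cases W)
    case (real w)
    have shift: "\<bar>(\<integral>z. g z \<theta> \<partial>D) - aug_risk \<theta>\<bar> \<le> w" if "\<theta> \<in> \<Theta>" for \<theta>
      using risk_displacement[OF that] real unfolding W_def[symmetric] aug_risk_def by simp
    have rad: "rademacher N T0 (\<lambda>n. h (S n)) \<le> rademacher N \<Theta> (\<lambda>n. h (S n))"
      by (rule rademacher_mono[OF T0(2,1)]) (rule h01(3))
    have "(\<integral>z. g z \<theta>a \<partial>D) - (\<integral>z. g z \<theta>s \<partial>D) \<le> 2 * rademacher N \<Theta> (\<lambda>n. h (S n)) + 5 * t + 2 * w"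
      using \<theta>0(2)[OF \<theta>s] shift[OF \<theta>a\<Theta>] shift[OF \<theta>0(1)] dense[OF \<theta>a\<Theta>] mc[OF \<theta>a\<Theta>] mc[OF \<theta>0(1)]
        min stat rad unfolding gap_stat_def abs_le_iff by linarith
    moreover have "enn2ereal (2 * W) = ereal (2 * w)"
    proof -
      have "2 * W = ennreal (2 * w)" using real by (simp add: ennreal_mult)
      then show ?thesis using real(1) by (simp add: enn2ereal_ennreal)
    qed
    ultimately show ?thesis unfolding LW by simp
  next
    case top
    then show ?thesis unfolding LW by (simp add: ennreal_mult_top enn2ereal_top)
  qed
qed

text \<open>Three events fail with probability at most \<open>\<delta> / 4\<close> each: the
  deviation of \<open>gap_stat\<close>, the tail condition on the training set, and the cell
  frequencies of the augmented graphs.\<close>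

lemma excess_risk_bound:
  assumes N: "N \<ge> 1" and \<delta>: "0 < \<delta>" "\<delta> < 1"
  shows "\<forall>\<^sub>F M in sequentially.
    with_prob_at_least (sample_measure D K N M) (1 - \<delta>) (\<lambda>(S, T).
      \<forall>\<theta>s \<theta>a.
        is_arg_min (train_risk l f N S) (\<lambda>\<theta>. \<theta> \<in> \<Theta>) \<theta>s \<longrightarrow>
        is_arg_min (aug_train_risk l f N M T) (\<lambda>\<theta>. \<theta> \<in> \<Theta>) \<theta>a \<longrightarrow>
        ereal ((\<integral>z. g z \<theta>a \<partial>D) - (\<integral>z. g z \<theta>s \<partial>D))
          \<le> ereal (2 * rademacher N \<Theta> (\<lambda>n. h (S n)) + 5 * sqrt (2 * ln (4 / \<delta>) / real N))
            + ereal (2 * L) * enn2ereal (\<integral>\<^sup>+ z. displacement \<nu> K z \<partial>D))"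
proof -
  let ?P = "train_measure D N"
  define t where "t = sqrt (2 * ln (4 / \<delta>) / real N)"
  have ln_pos: "ln (4 / \<delta>) > 0" using \<delta> by simp
  then have t: "t > 0" "t\<^sup>2 = 2 * ln (4 / \<delta>) / real N" using N by (auto simp: t_def)
  obtain T0 where T0: "countable T0" "T0 \<noteq> {}" "T0 \<subseteq> \<Theta>"
    and dense: "\<And>\<theta> N S. \<theta> \<in> \<Theta> \<Longrightarrow> aug_risk \<theta> - emp_risk N S \<theta> \<le> (SUP \<theta>\<in>T0. aug_risk \<theta> - emp_risk N S \<theta>)"
    using dense_parameters by metis
  \<comment> \<open>The infimum of the population risk need not be attained. The near-minimizer is
    chosen from \<open>D\<close> alone, before any sample is drawn.\<close>
  obtain \<theta>0 where \<theta>0: "\<theta>0 \<in> \<Theta>" "\<And>\<theta>. \<theta> \<in> \<Theta> \<Longrightarrow> (\<integral>z. g z \<theta>0 \<partial>D) \<le> (\<integral>z. g z \<theta> \<partial>D) + t"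
  proof -
    have bdd: "bdd_below ((\<lambda>\<theta>. \<integral>z. g z \<theta> \<partial>D) ` \<Theta>)"
      by (intro bdd_belowI2[of _ 0] Bochner_Integration.integral_nonneg g01)
    have "(INF \<theta>\<in>\<Theta>. \<integral>z. g z \<theta> \<partial>D) < (INF \<theta>\<in>\<Theta>. \<integral>z. g z \<theta> \<partial>D) + t" using t by simp
    then obtain \<theta>0 where \<theta>0: "\<theta>0 \<in> \<Theta>" "(\<integral>z. g z \<theta>0 \<partial>D) < (INF \<theta>\<in>\<Theta>. \<integral>z. g z \<theta> \<partial>D) + t"
      using cINF_less_iff[OF \<Theta>_ne bdd] by blast
    have "(\<integral>z. g z \<theta>0 \<partial>D) \<le> (\<integral>z. g z \<theta> \<partial>D) + t" if "\<theta> \<in> \<Theta>" for \<theta>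
      using \<theta>0(2) cINF_lower[OF bdd that] by linarith
    then show ?thesis using that \<theta>0(1) by blast
  qed
  have "2 * t > 0" using t by simp
  note stat = gap_stat_deviation[OF T0(1,3,2) \<theta>0(1) N this]
  define A1 where "A1 = {S \<in> space ?P. gap_stat T0 \<theta>0 N S < 2 * t}"
  have A1: "A1 \<in> sets ?P" using stat(1) unfolding A1_def by measurable
  \<comment> \<open>At threshold \<open>2 * t\<close> the exponent is
    \<open>- (N * t\<^sup>2 / 2)\<close>, that is \<open>- ln (4 / \<delta>)\<close>, which gives
    failure probability \<open>\<delta> / 4\<close>.\<close>
  have "- (real N * (2 * t)\<^sup>2 / 8) = - ln (4 / \<delta>)" using N by (simp add: power_mult_distrib t(2))
  then have "exp (- (real N * (2 * t)\<^sup>2 / 8)) = \<delta> / 4" using \<delta> by (simp add: exp_minus)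
  moreover have "space ?P - A1 = {S \<in> space ?P. gap_stat T0 \<theta>0 N S \<ge> 2 * t}" by (auto simp: A1_def)
  ultimately have PA1: "measure ?P A1 \<ge> 1 - \<delta> / 4"
    using stat(2) train.prob_compl[OF A1] by simp
  obtain A2 where A2: "A2 \<in> sets ?P" "measure ?P A2 \<ge> 1 - \<delta> / 4"
    and ev: "\<forall>\<^sub>F M in sequentially. \<exists>B \<in> sets (?P \<Otimes>\<^sub>M PiM ({..<N} \<times> {..<M}) (\<lambda>_. D)).
      (\<forall>S\<in>space ?P. measure (aug_measure K N M S) {T \<in> space (PiM ({..<N} \<times> {..<M}) (\<lambda>_. D)). (S, T) \<in> B} \<ge> 1 - \<delta> / 4) \<and>
      (\<forall>S T. S \<in> A2 \<longrightarrow> (S, T) \<in> B \<longrightarrow> (\<forall>\<theta>\<in>\<Theta>. \<bar>aug_train_risk l f N M T \<theta> - emp_risk N S \<theta>\<bar> \<le> t))"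
    using uniform_monte_carlo[OF N t(1), of "\<delta> / 4"] \<delta> by auto
  have A: "A1 \<inter> A2 \<in> sets ?P" "measure ?P (A1 \<inter> A2) \<ge> 1 - \<delta> / 2"
    using train.prob_Int_ge[OF A1 A2(1) PA1 A2(2)] A1 A2(1) by auto
  show ?thesis using ev
  proof eventually_elim
    case (elim M)
    let ?Q = "PiM ({..<N} \<times> {..<M}) (\<lambda>_. D)"
    obtain B where B: "B \<in> sets (?P \<Otimes>\<^sub>M ?Q)"
      "\<And>S. S \<in> space ?P \<Longrightarrow> measure (aug_measure K N M S) {T \<in> space ?Q. (S, T) \<in> B} \<ge> 1 - \<delta> / 4"
      and good: "\<And>S T \<theta>. S \<in> A2 \<Longrightarrow> (S, T) \<in> B \<Longrightarrow> \<theta> \<in> \<Theta> \<Longrightarrow> \<bar>aug_train_risk l f N M T \<theta> - emp_risk N S \<theta>\<bar> \<le> t"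
      using elim by blast
    let ?E = "B \<inter> ((A1 \<inter> A2) \<times> space ?Q)"
    \<comment> \<open>\<open>A1\<close> and \<open>A2\<close> concern the training set only;
      \<open>B\<close> also involves the augmented graphs and is controlled conditionally on every
      training set.\<close>
    note E = train.measure_dependent_event[OF aug_measure_kernel A B, folded sample_measure_def]
    show ?case
      unfolding with_prob_at_least_def
    proof (intro bexI[of _ ?E] conjI ballI)
      show "?E \<in> sets (sample_measure D K N M)"
        using E(1) A(1) B(1) \<delta> by (auto intro!: sets.Int)
      show "measure (sample_measure D K N M) ?E \<ge> 1 - \<delta>"
        using E(2) \<delta> by simp
      fix ST assume "ST \<in> ?E"
      then obtain S T where ST: "ST = (S, T)" "S \<in> A1" "S \<in> A2" "(S, T) \<in> B" by auto
      show "case ST of (S, T) \<Rightarrow> \<forall>\<theta>s \<theta>a.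
        is_arg_min (train_risk l f N S) (\<lambda>\<theta>. \<theta> \<in> \<Theta>) \<theta>s \<longrightarrow>
        is_arg_min (aug_train_risk l f N M T) (\<lambda>\<theta>. \<theta> \<in> \<Theta>) \<theta>a \<longrightarrow>
        ereal ((\<integral>z. g z \<theta>a \<partial>D) - (\<integral>z. g z \<theta>s \<partial>D))
          \<le> ereal (2 * rademacher N \<Theta> (\<lambda>n. h (S n)) + 5 * sqrt (2 * ln (4 / \<delta>) / real N))
            + ereal (2 * L) * enn2ereal (\<integral>\<^sup>+ z. displacement \<nu> K z \<partial>D)"
        unfolding ST(1) prod.case t_def[symmetric]
      proof (intro allI impI)
        fix \<theta>s \<theta>a
        assume s: "is_arg_min (train_risk l f N S) (\<lambda>\<theta>. \<theta> \<in> \<Theta>) \<theta>s"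
          and a: "is_arg_min (aug_train_risk l f N M T) (\<lambda>\<theta>. \<theta> \<in> \<Theta>) \<theta>a"
        have "\<theta>s \<in> \<Theta>" using s by (simp add: is_arg_min_def)
        moreover have "gap_stat T0 \<theta>0 N S \<le> 2 * t" using ST(2) by (simp add: A1_def)
        ultimately show "ereal ((\<integral>z. g z \<theta>a \<partial>D) - (\<integral>z. g z \<theta>s \<partial>D))
          \<le> ereal (2 * rademacher N \<Theta> (\<lambda>n. h (S n)) + 5 * t)
            + ereal (2 * L) * enn2ereal (\<integral>\<^sup>+ z. displacement \<nu> K z \<partial>D)"
          using excess_risk_le[OF dense T0(2,3) \<theta>0 _ good[OF ST(3,4)] _ a] by blast
      qed
    qed
  qed
qed

end

text \<open>The right-hand side has no term for the error of sampling finitely many augmentations.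
  The probability bound is therefore asserted for all sufficiently large \<open>M\<close>, when that
  error fits into the \<open>5 * sqrt\<close> term. Extended reals admit an infinite expected
  displacement.\<close>

theorem theorem3p1:
  fixes D :: "('n::finite, 'd::finite, 'y::countable) lgraph measure"
    and A :: "'a \<Rightarrow> ('n, 'd, 'y) lgraph \<Rightarrow> ('n, 'd, 'y) lgraph measure"
    and lam :: 'a
    and \<nu> :: "('n, 'd) graph \<Rightarrow> real"
    and f :: "('n, 'd) graph \<Rightarrow> 't \<Rightarrow> 'p"
    and l :: "'p \<Rightarrow> 'y \<Rightarrow> real"
    and \<Theta> :: "'t set"
    and L \<delta> :: real
    and N :: nat
  assumes "prob_space D" and "sets D = sets lgraphs"
    and "A lam \<in> lgraphs \<rightarrow>\<^sub>M prob_algebra lgraphs"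
    and "is_norm \<nu>"
    and "\<Theta> \<noteq> {}"
    and "\<And>p y. l p y \<in> {0..1}"
    and "lipschitz_loss \<nu> L \<Theta> l f (A lam)"
    and "N \<ge> 1" and "0 < \<delta>" and "\<delta> < 1"
  shows "(\<forall>\<^sub>F M in sequentially.
            with_prob_at_least (sample_measure D (A lam) N M) (1 - \<delta>) (\<lambda>(S, T).
              \<forall>\<theta>s \<theta>a.
                is_arg_min (train_risk l f N S) (\<lambda>\<theta>. \<theta> \<in> \<Theta>) \<theta>s \<longrightarrow>
                is_arg_min (aug_train_risk l f N M T) (\<lambda>\<theta>. \<theta> \<in> \<Theta>) \<theta>a \<longrightarrow>
                ereal ((\<integral>z. gloss l f z \<theta>a \<partial>D) - (\<integral>z. gloss l f z \<theta>s \<partial>D))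
                  \<le> ereal (2 * rademacher N \<Theta> (\<lambda>n. aug_loss l f (A lam) (S n))
                           + 5 * sqrt (2 * ln (4 / \<delta>) / real N))
                    + ereal (2 * L) * enn2ereal (\<integral>\<^sup>+ z. displacement \<nu> (A lam) z \<partial>D)))
       \<and> (\<forall>S :: nat \<Rightarrow> ('n, 'd, 'y) lgraph.
            ereal (rademacher N \<Theta> (\<lambda>n. aug_loss l f (A lam) (S n)))
              \<le> ereal (rademacher N \<Theta> (\<lambda>n. gloss l f (S n)))
                + (MAX n\<in>{..<N}. ereal L * enn2ereal (displacement \<nu> (A lam) (S n))))"
proof -
  interpret graph_augmentation D "A lam" \<nu> f l \<Theta> L
    by (rule graph_augmentation.intro) (fact assms)+
  show ?thesis
    using excess_risk_bound[OF assms(8-10)] rademacher_aug_le[OF assms(8)] by blast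
qed

end
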